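(* Let $\mathcal M$ be a matrix class of $0,1$-matrices that does not contain every permutation matrix. Then $k$-Biclique restricted to inputs from $\mathcal M$ is fixed-parameter tractable: there are a computable $h$ and an algorithm that, given $M\in\mathcal M$ and $k$, decides whether $M$ has a $k\times k$ submatrix all of whose entries are $1$ in time $h(k)\cdot|M|^{\mathcal O(1)}$.
   Context: A matrix class is a set of matrices closed under taking submatrices (deleting rows and/or columns). A permutation matrix is a square $0,1$-matrix with exactly one $1$-entry in each row and each column. A submatrix is obtained by deleting rows and columns (not necessarily consecutive). *)

theory Defs
  imports "Jordan_Normal_Form.DL_Submatrix"
begin

section \<open>Matrix classes and bicliques\<close>

definition zero_one_mat :: "nat mat \<Rightarrow> bool" where
  "zero_one_mat A \<longleftrightarrow> (\<forall>i < dim_row A. \<forall>j < dim_col A. A $$ (i, j) \<in> {0, 1})"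

definition permutation_mat :: "nat mat \<Rightarrow> bool" where
  "permutation_mat P \<longleftrightarrow>
     square_mat P \<and> zero_one_mat P \<and>
     (\<forall>i < dim_row P. \<exists>!j. j < dim_col P \<and> P $$ (i, j) = 1) \<and>
     (\<forall>j < dim_col P. \<exists>!i. i < dim_row P \<and> P $$ (i, j) = 1)"

text \<open>
  \<^term>\<open>submatrix A I J\<close> keeps the rows with index in \<open>I\<close> and the columns with index in \<open>J\<close>,
  in their original order; elements of \<open>I\<close> and \<open>J\<close> outside the index range are ignored.
  Matrices with no rows or no columns are allowed. This is harmless: a nonempty class always
  contains the 0 by 0 matrix.
\<close>

definition matrix_class :: "nat mat set \<Rightarrow> bool" where
  "matrix_class \<M> \<longleftrightarrow> (\<forall>A \<in> \<M>. \<forall>I J. submatrix A I J \<in> \<M>)"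

definition has_biclique :: "nat mat \<Rightarrow> nat \<Rightarrow> bool" where
  "has_biclique M k \<longleftrightarrow> (\<exists>I J. submatrix M I J = mat k k (\<lambda>_. 1))"


section \<open>Model of computation\<close>

text \<open>
  Algorithms are programs of Jones' language WHILE (Neil D. Jones, Computability and Complexity
  from a Programming Perspective, MIT Press 1997): imperative programs with finitely many
  variables, whose values are binary trees, with unit cost for each elementary operation. \<open>ECons\<close>
  at unit cost is realistic because a tree is represented by a pointer and subtrees are shared.
  There is no equality test on trees, only a test for being a leaf. This model is Turing complete,
  and it simulates and is simulated by (multitape) Turing machines with polynomial overhead in
  time, so that computability and fixed-parameter tractability have their usual meaning.
\<close>

datatype tree = Leaf | Node tree tree

fun left :: "tree \<Rightarrow> tree" where
  "left Leaf = Leaf"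
| "left (Node a b) = a"

fun right :: "tree \<Rightarrow> tree" where
  "right Leaf = Leaf"
| "right (Node a b) = b"

fun leaves :: "tree \<Rightarrow> nat" where
  "leaves Leaf = 1"
| "leaves (Node a b) = leaves a + leaves b"

datatype exp = EVar nat | ELeaf | ECons exp exp | EHd exp | ETl exp

datatype com =
    Skip
  | Assign nat exp
  | Seq com com
  | Cond exp com com
  | While exp com

type_synonym state = "nat \<Rightarrow> tree"

fun val :: "exp \<Rightarrow> state \<Rightarrow> tree" where
  "val (EVar x) s = s x"
| "val ELeaf s = Leaf"
| "val (ECons e f) s = Node (val e s) (val f s)"
| "val (EHd e) s = left (val e s)"
| "val (ETl e) s = right (val e s)"

fun cost :: "exp \<Rightarrow> nat" where
  "cost (EVar x) = 1"
| "cost ELeaf = 1"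
| "cost (ECons e f) = 1 + cost e + cost f"
| "cost (EHd e) = 1 + cost e"
| "cost (ETl e) = 1 + cost e"

text \<open>
  \<open>exec c s t s'\<close>: command \<open>c\<close> started in state \<open>s\<close> terminates after time \<open>t\<close> in state \<open>s'\<close>.
\<close>

inductive exec :: "com \<Rightarrow> state \<Rightarrow> nat \<Rightarrow> state \<Rightarrow> bool" where
  Skip: "exec Skip s 1 s"
| Assign: "exec (Assign x e) s (1 + cost e) (s(x := val e s))"
| Seq: "exec c s t s' \<Longrightarrow> exec d s' u s'' \<Longrightarrow> exec (Seq c d) s (t + u) s''"
| CondTrue: "val e s \<noteq> Leaf \<Longrightarrow> exec c s t s' \<Longrightarrow> exec (Cond e c d) s (1 + cost e + t) s'"
| CondFalse: "val e s = Leaf \<Longrightarrow> exec d s t s' \<Longrightarrow> exec (Cond e c d) s (1 + cost e + t) s'"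
| WhileFalse: "val e s = Leaf \<Longrightarrow> exec (While e c) s (1 + cost e) s"
| WhileTrue: "val e s \<noteq> Leaf \<Longrightarrow> exec c s t s' \<Longrightarrow> exec (While e c) s' u s'' \<Longrightarrow>
    exec (While e c) s (1 + cost e + t + u) s''"

inductive_cases exec_elims:
  "exec Skip s t s'"
  "exec (Assign x e) s t s'"
  "exec (Seq c d) s t s'"
  "exec (Cond e c d) s t s'"
  "exec (While e c) s t s'"

lemma exec_deterministic: "exec c s t s' \<Longrightarrow> exec c s u s'' \<Longrightarrow> t = u \<and> s' = s''"
proof (induction arbitrary: u s'' rule: exec.induct)
  case (Skip s)
  from Skip show ?case by (rule exec_elims(1)) simp
next
  case (Assign x e s)
  from Assign show ?case by (rule exec_elims(2)) simp
next
  case (Seq c s t1 s1 d t2 s2)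
  from Seq.prems obtain v1 v2 r where
    *: "exec c s v1 r" "exec d r v2 s''" "u = v1 + v2"
    by (rule exec_elims(3))
  from Seq.IH(1)[OF *(1)] have "t1 = v1" "s1 = r" by simp_all
  with Seq.IH(2)[of v2 s''] *(2,3) show ?case by simp
next
  case (CondTrue e s c t1 s1 d)
  from CondTrue.prems CondTrue.hyps(1) obtain v where
    *: "exec c s v s''" "u = 1 + cost e + v"
    by (auto elim: exec_elims(4))
  from CondTrue.IH[OF *(1)] *(2) show ?case by simp
next
  case (CondFalse e s d t1 s1 c)
  from CondFalse.prems CondFalse.hyps(1) obtain v where
    *: "exec d s v s''" "u = 1 + cost e + v"
    by (auto elim: exec_elims(4))
  from CondFalse.IH[OF *(1)] *(2) show ?case by simp
next
  case (WhileFalse e s c)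
  from WhileFalse.prems WhileFalse.hyps(1) show ?case
    by (auto elim: exec_elims(5))
next
  case (WhileTrue e s c t1 s1 t2 s2)
  from WhileTrue.prems WhileTrue.hyps(1) obtain v1 r v2 where
    *: "exec c s v1 r" "exec (While e c) r v2 s''" "u = 1 + cost e + v1 + v2"
    by (auto elim: exec_elims(5))
  from WhileTrue.IH(1)[OF *(1)] have "t1 = v1" "s1 = r" by simp_all
  with WhileTrue.IH(2)[of v2 s''] *(2,3) show ?case by simp
qed

text \<open>Variable 0 holds the input at the start and the output at the end.\<close>

definition runs :: "com \<Rightarrow> tree \<Rightarrow> nat \<Rightarrow> tree \<Rightarrow> bool" where
  "runs p x t y \<longleftrightarrow> (\<exists>s. exec p ((\<lambda>_. Leaf)(0 := x)) t s \<and> s 0 = y)"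


section \<open>Encodings and fixed-parameter tractability\<close>

definition enc_bool :: "bool \<Rightarrow> tree" where
  "enc_bool b = (if b then Node Leaf Leaf else Leaf)"

fun enc_list :: "tree list \<Rightarrow> tree" where
  "enc_list [] = Leaf"
| "enc_list (x # xs) = Node x (enc_list xs)"

text \<open>Numbers are in unary.\<close>

definition enc_nat :: "nat \<Rightarrow> tree" where
  "enc_nat n = enc_list (replicate n Leaf)"

text \<open>
  A matrix is encoded as the list of its rows. (All matrices without rows get the same code.)
\<close>

definition enc_mat :: "nat mat \<Rightarrow> tree" where
  "enc_mat A = enc_list (map (\<lambda>i. enc_list (map (\<lambda>j. enc_bool (A $$ (i, j) = 1))
     [0..<dim_col A])) [0..<dim_row A])"

lemma leaves_enc_list: "leaves (enc_list xs) = sum_list (map leaves xs) + 1"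
  by (induction xs) auto

text \<open>For matrices with at least one row and column, the size of the encoding is within constant
  factors of the number of entries.\<close>

lemma leaves_enc_mat_bounds:
  "dim_row A * dim_col A \<le> leaves (enc_mat A)"
  "leaves (enc_mat A) \<le> dim_row A * (2 * dim_col A + 1) + 1"
proof -
  define r where "r i = enc_list (map (\<lambda>j. enc_bool (A $$ (i, j) = 1)) [0..<dim_col A])" for i
  have b: "1 \<le> leaves (enc_bool c)" "leaves (enc_bool c) \<le> 2" for c
    by (simp_all add: enc_bool_def)
  have r: "leaves (r i) = (\<Sum>j<dim_col A. leaves (enc_bool (A $$ (i, j) = 1))) + 1" for i
    by (simp add: r_def leaves_enc_list o_def interv_sum_list_conv_sum_set_nat atLeast0LessThan)
  have m: "leaves (enc_mat A) = (\<Sum>i<dim_row A. leaves (r i)) + 1"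
    unfolding enc_mat_def r_def[symmetric]
    by (simp add: leaves_enc_list o_def interv_sum_list_conv_sum_set_nat atLeast0LessThan)
  have lo: "dim_col A \<le> leaves (r i)" for i
  proof -
    have "(\<Sum>j<dim_col A. 1) \<le> (\<Sum>j<dim_col A. leaves (enc_bool (A $$ (i, j) = 1)))"
      by (intro sum_mono b(1))
    then show ?thesis by (simp add: r)
  qed
  have hi: "leaves (r i) \<le> 2 * dim_col A + 1" for i
  proof -
    have "(\<Sum>j<dim_col A. leaves (enc_bool (A $$ (i, j) = 1))) \<le> (\<Sum>j<dim_col A. 2)"
      by (intro sum_mono b(2))
    then show ?thesis by (simp add: r)
  qed
  have "(\<Sum>i<dim_row A. dim_col A) \<le> (\<Sum>i<dim_row A. leaves (r i))"
    by (intro sum_mono lo)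
  then show "dim_row A * dim_col A \<le> leaves (enc_mat A)" by (simp add: m)
  have "(\<Sum>i<dim_row A. leaves (r i)) \<le> (\<Sum>i<dim_row A. 2 * dim_col A + 1)"
    by (intro sum_mono hi)
  then show "leaves (enc_mat A) \<le> dim_row A * (2 * dim_col A + 1) + 1" by (simp add: m)
qed

definition computable :: "(nat \<Rightarrow> nat) \<Rightarrow> bool" where
  "computable h \<longleftrightarrow> (\<exists>p. \<forall>n. \<exists>t. runs p (enc_nat n) t (enc_nat (h n)))"

text \<open>
  \<open>fpt_on X enc Q\<close>: the problem of deciding, for given \<open>x \<in> X\<close> and parameter \<open>k\<close>, whether \<open>Q x k\<close>
  holds is fixed-parameter tractable. Nothing is required of the program on inputs outside \<open>X\<close>.
  Since \<open>k\<close> is not counted in the size, the choice of its encoding is irrelevant (up to changing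
  \<open>h\<close>).
\<close>

definition fpt_on :: "'a set \<Rightarrow> ('a \<Rightarrow> tree) \<Rightarrow> ('a \<Rightarrow> nat \<Rightarrow> bool) \<Rightarrow> bool" where
  "fpt_on X enc Q \<longleftrightarrow>
     (\<exists>h c p. computable h \<and>
        (\<forall>x \<in> X. \<forall>k. \<exists>t. runs p (Node (enc x) (enc_nat k)) t (enc_bool (Q x k)) \<and>
           t \<le> h k * leaves (enc x) ^ c))"

end

theory Submission
  imports Defs
begin

text \<open>
  Let \<open>P\<close> be a permutation matrix of size \<open>s\<close> that is not in the class, and suppose that a matrix of
  the class has no all-ones \<open>k \<times> k\<close> submatrix. Inflate each one of \<open>P\<close> to an identity matrix whose size
  depends only on \<open>k\<close> and \<open>s\<close>. If the ones of this inflation occurred as a pattern, then, the matrix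
  being sparse between any two blocks, one could pick one point per block such that all other
  entries between the picked points are zero, which gives \<open>P\<close> as a submatrix. Hence the inflated
  pattern is avoided, and by the theorem of Marcus and Tardos every submatrix has a row or a column
  with at most \<open>d\<close> ones, for some \<open>d\<close> that depends only on \<open>k\<close> and \<open>s\<close>. Deleting such lines one by one
  shows that the number of nonempty sets of rows with at least \<open>k\<close> common columns is at most
  \<open>2 ^ (d + k)\<close> times the number of lines.

  The algorithm reads the rows one by one, maintains the list of all these sets, and stops as soon
  as one of them has \<open>k\<close> elements. Until then the rows read contain no biclique, so the list is
  short. The program does not need to know \<open>d\<close>; only the bound on its running time does.
\<close>

section \<open>Permutation patterns\<close>

text \<open>The obstacle is that extremal theory controls containment, where the zeros of a pattern
  are free, while a class excludes \<open>P\<close> only as an exact submatrix. Freeness of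
  bicliques pays for the zeros: towards any large set of columns fewer than \<open>8 * k\<close>
  rows are dense, so each greedy choice of a point costs the remaining blocks at most half of their
  candidates. The identity blocks exist to offer these candidates, all of which lie in the same
  relative position to the other blocks.

  The stored sets are closed under nonempty subsets, so reading a row takes just one attempted
  extension per stored set. The row that completes the first biclique is still processed with the
  list of a biclique-free prefix, so even the last round is cheap.

  As \<open>h\<close> must be computed by a program, the nested exponentials in the bound have to be
  dominated by a function computable in the WHILE language. Unary functions under composition and
  iteration suffice for this.\<close>

text \<open>Containment in the sense of extremal matrix theory: positions off the permutation are
  unrestricted, which makes the notion monotone in \<open>S\<close> and lets it be lifted back from
  contractions.\<close>

definition has_pattern :: "nat \<Rightarrow> (nat \<Rightarrow> nat) \<Rightarrow> (nat \<times> nat) set \<Rightarrow> bool" where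
  "has_pattern q \<sigma> S \<longleftrightarrow> (\<exists>r c. strict_mono_on {..<q} r \<and> strict_mono_on {..<q} c \<and>
     (\<forall>i<q. (r i, c (\<sigma> i)) \<in> S))"

lemma has_patternI:
  assumes "strict_mono_on {..<q} r" "strict_mono_on {..<q} c" "\<And>i. i < q \<Longrightarrow> (r i, c (\<sigma> i)) \<in> S"
  shows "has_pattern q \<sigma> S"
  using assms unfolding has_pattern_def by blast

lemma has_pattern_0 [simp]: "has_pattern 0 \<sigma> S"
  by (rule has_patternI[where r = id and c = id]) (auto simp: strict_mono_on_def)

text \<open>Weakly monotone maps reflect strict inequalities, so arbitrary preimages of the points
  of an occurrence are again in the right order. The preimages are indexed by rows;
  \<open>\<tau>\<close> finds the one that belongs to a given column.\<close>

lemma has_pattern_map_prod: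
  fixes f g :: "nat \<Rightarrow> nat"
  assumes \<sigma>: "bij_betw \<sigma> {..<q} {..<q}" and fg: "mono f" "mono g"
    and "has_pattern q \<sigma> (map_prod f g ` S)"
  shows "has_pattern q \<sigma> S"
proof -
  from assms(4) obtain r c where rc: "strict_mono_on {..<q} r" "strict_mono_on {..<q} c"
    "\<And>i. i < q \<Longrightarrow> (r i, c (\<sigma> i)) \<in> map_prod f g ` S"
    unfolding has_pattern_def by blast
  have "\<forall>i. \<exists>p. i < q \<longrightarrow> p \<in> S \<and> f (fst p) = r i \<and> g (snd p) = c (\<sigma> i)"
    using rc(3) by (fastforce simp: image_iff)
  then obtain p where p: "\<And>i. i < q \<Longrightarrow> p i \<in> S \<and> f (fst (p i)) = r i \<and> g (snd (p i)) = c (\<sigma> i)"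
    by metis
  define \<tau> where "\<tau> = inv_into {..<q} \<sigma>"
  have \<tau>: "\<tau> j < q" "\<sigma> (\<tau> j) = j" if "j < q" for j
    using that \<sigma> inv_into_into[of j \<sigma> "{..<q}"] f_inv_into_f[of j \<sigma> "{..<q}"]
    by (auto simp: \<tau>_def bij_betw_def)
  have \<tau>\<sigma>: "\<tau> (\<sigma> i) = i" if "i < q" for i
    using that \<sigma> by (simp add: \<tau>_def bij_betw_def)
  show ?thesis
  proof (rule has_patternI)
    show "strict_mono_on {..<q} (\<lambda>i. fst (p i))"
      using p rc(1) fg(1) by (intro strict_mono_onI) (metis lessThan_iff monoD not_le strict_mono_onD)
    show "strict_mono_on {..<q} (\<lambda>j. snd (p (\<tau> j)))"
    proof (intro strict_mono_onI)
      fix i j assume ij: "i \<in> {..<q}" "j \<in> {..<q}" "i < j"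
      then have "g (snd (p (\<tau> i))) < g (snd (p (\<tau> j)))"
        using p \<tau> rc(2) by (simp add: strict_mono_onD)
      then show "snd (p (\<tau> i)) < snd (p (\<tau> j))"
        using fg(2) by (metis monoD not_le)
    qed
    show "(fst (p i), snd (p (\<tau> (\<sigma> i)))) \<in> S" if "i < q" for i
      using p that by (simp add: \<tau>\<sigma>)
  qed
qed

text \<open>Transposition inverts the permutation. Through this the bound for blocks with many
  columns also serves for blocks with many rows.\<close>

lemma has_pattern_converse:
  assumes \<sigma>: "bij_betw \<sigma> {..<q} {..<q}" and "has_pattern q (inv_into {..<q} \<sigma>) (S\<inverse>)"
  shows "has_pattern q \<sigma> S"
proof -
  from assms(2) obtain r c where rc: "strict_mono_on {..<q} r" "strict_mono_on {..<q} c"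
    "\<And>i. i < q \<Longrightarrow> (c (inv_into {..<q} \<sigma> i), r i) \<in> S"
    unfolding has_pattern_def by blast
  have "(c i, r (\<sigma> i)) \<in> S" if "i < q" for i
    using rc(3)[of "\<sigma> i"] that \<sigma> by (auto simp: bij_betw_def)
  then show ?thesis
    using rc by (intro has_patternI[of q c r])
qed

lemma strict_mono_on_pick: "q \<le> card V \<Longrightarrow> strict_mono_on {..<q} (pick V)"
  by (intro strict_mono_onI) (auto intro!: pick_mono_le)

lemma pick_mem: "q \<le> card V \<Longrightarrow> i < q \<Longrightarrow> pick V i \<in> V"
  by (rule pick_in_set_le) simp

section \<open>Block decomposition and the Marcus-Tardos theorem\<close>

lemma pigeonhole_subsets:
  assumes "finite A" "finite U" "\<And>a. a \<in> A \<Longrightarrow> g a \<subseteq> U" "q * 2 ^ card U \<le> card A"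
  obtains V where "V \<subseteq> U" "q \<le> card {a \<in> A. g a = V}"
proof -
  have "\<exists>V\<in>Pow U. card A \<le> card (g -` {V} \<inter> A) * card (Pow U)"
    by (rule pigeonhole_card) (use assms in auto)
  then obtain V where V: "V \<subseteq> U" "card A \<le> card (g -` {V} \<inter> A) * 2 ^ card U"
    using assms(2) by (auto simp: card_Pow)
  have "q * 2 ^ card U \<le> card (g -` {V} \<inter> A) * 2 ^ card U"
    using V(2) assms(4) by linarith
  then have "q \<le> card (g -` {V} \<inter> A)" by simp
  moreover have "g -` {V} \<inter> A = {a \<in> A. g a = V}" by auto
  ultimately show ?thesis using that V(1) by simp
qed

lemma less_block_end: "0 < m \<Longrightarrow> x < x div m * m + m" for m x :: nat
  using dividend_less_div_times[of m x] by simp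

text \<open>Each block of block column \<open>b\<close> is described by the set of columns that it
  occupies, one of \<open>2 ^ m\<close> sets. With too many wide blocks, \<open>q\<close> of them
  occupy the same set \<open>V\<close> of at least \<open>q\<close> columns. The \<open>i\<close>-th
  of these blocks then supplies a point in any desired column of \<open>V\<close>, and since the
  blocks are stacked the rows come out increasing.\<close>

lemma card_wide_blocks:
  fixes S :: "(nat \<times> nat) set"
  assumes "finite S" "0 < m" "\<not> has_pattern q \<sigma> S" "bij_betw \<sigma> {..<q} {..<q}"
  shows "card {a. q \<le> card {j. \<exists>i. (i, j) \<in> S \<and> i div m = a \<and> j div m = b}} \<le> q * 2 ^ m"
    (is "card ?A \<le> _")
proof (rule ccontr)
  assume large: "\<not> ?thesis"
  define g where "g a = {j. \<exists>i. (i, j) \<in> S \<and> i div m = a \<and> j div m = b}" for a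
  have q: "0 < q" using assms(3) by (cases q) auto
  have "?A \<subseteq> (\<lambda>p. fst p div m) ` S"
  proof
    fix a assume "a \<in> ?A"
    then have "q \<le> card (g a)" by (simp add: g_def)
    then have "g a \<noteq> {}" using q by auto
    then show "a \<in> (\<lambda>p. fst p div m) ` S" by (force simp: g_def)
  qed
  then have fin: "finite ?A" using assms(1) by (rule finite_surj[rotated])
  have sub: "g a \<subseteq> {b * m..<b * m + m}" for a
    by (auto simp: g_def less_block_end[OF assms(2)])
  obtain V where V: "V \<subseteq> {b * m..<b * m + m}" "q \<le> card {a \<in> ?A. g a = V}"
    by (rule pigeonhole_subsets[of ?A "{b * m..<b * m + m}" g q])
       (use fin large sub in auto)
  let ?B = "{a \<in> ?A. g a = V}"
  have "?B \<noteq> {}" using V(2) q by (metis card.empty not_less)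
  then obtain a0 where "a0 \<in> ?B" by blast
  then have cV: "q \<le> card V" unfolding g_def by blast
  have \<sigma>: "\<sigma> i < q" if "i < q" for i using that assms(4) by (auto simp: bij_betw_def)
  have "\<exists>x. (x, pick V (\<sigma> i)) \<in> S \<and> x div m = pick ?B i" if "i < q" for i
  proof -
    have "pick V (\<sigma> i) \<in> V" "pick ?B i \<in> ?B"
      using pick_mem[OF cV \<sigma>[OF that]] pick_mem[OF V(2) that] by blast+
    then have "pick V (\<sigma> i) \<in> g (pick ?B i)" by simp
    then show ?thesis by (auto simp: g_def)
  qed
  then have "\<forall>i\<in>{..<q}. \<exists>x. (x, pick V (\<sigma> i)) \<in> S \<and> x div m = pick ?B i" by blast
  from bchoice[OF this] obtain x
    where x: "\<And>i. i < q \<Longrightarrow> (x i, pick V (\<sigma> i)) \<in> S \<and> x i div m = pick ?B i"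
    by blast
  have "strict_mono_on {..<q} x"
  proof (intro strict_mono_onI)
    fix i j assume ij: "i \<in> {..<q}" "j \<in> {..<q}" "i < j"
    then have "pick ?B i < pick ?B j" 
      using strict_mono_onD[OF strict_mono_on_pick[OF V(2)]] by blast
    then have "x i div m < x j div m" using x[of i] x[of j] ij(1,2) by simp
    then show "x i < x j" by (meson div_le_mono not_le)
  qed
  then have "has_pattern q \<sigma> S"
    by (rule has_patternI[OF _ strict_mono_on_pick[OF cV]]) (use x in auto)
  with assms(3) show False by simp
qed

lemma card_eq_sum_fibres:
  assumes "finite T" "f ` S \<subseteq> T" "finite S"
  shows "card S = (\<Sum>b\<in>T. card {p \<in> S. f p = b})"
proof -
  have "card S = (\<Sum>p\<in>S. 1)" by simp
  also have "\<dots> = (\<Sum>b\<in>T. \<Sum>p | p \<in> S \<and> f p = b. 1)"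
    by (rule sum.group[symmetric]) (use assms in auto)
  finally show ?thesis by simp
qed

text \<open>The blocks have side \<open>m = 4 * q * q\<close>; each block column has at most \<open>q * 2 ^ m\<close> wide blocks
  (and likewise for tall ones), and each of these has at most \<open>m * m\<close> points.\<close>

definition mt_const :: "nat \<Rightarrow> nat" where
  "mt_const q = 2 * q * 2 ^ (4 * q * q) * (4 * q * q) * (4 * q * q)"

text \<open>A block that is neither wide nor tall lies in a product of fewer than \<open>q\<close>
  rows and fewer than \<open>q\<close> columns, and \<open>card S'\<close> counts the nonempty
  blocks. The others are few by \<open>card_wide_blocks\<close> and its transpose, and are charged
  \<open>m * m\<close> each.\<close>

lemma card_block_decomposition:
  fixes S :: "(nat \<times> nat) set"
  assumes \<sigma>: "bij_betw \<sigma> {..<q} {..<q}" and np: "\<not> has_pattern q \<sigma> S" and "0 < m"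
    and S: "S \<subseteq> {..<n} \<times> {..<n}" and n': "n' = n div m + 1"
    and S': "S' = map_prod (\<lambda>i. i div m) (\<lambda>j. j div m) ` S"
  shows "card S \<le> q * q * card S' + 2 * n' * q * 2 ^ m * (m * m)"
proof -
  let ?f = "map_prod (\<lambda>i. i div m) (\<lambda>j. j div m) :: nat \<times> nat \<Rightarrow> nat \<times> nat"
  have fin: "finite S" using S by (rule finite_subset) auto
  then have finc: "finite (S\<inverse>)" by simp
  have npc: "\<not> has_pattern q (inv_into {..<q} \<sigma>) (S\<inverse>)"
    using np has_pattern_converse[OF \<sigma>] by blast
  have sub': "S' \<subseteq> {..<n'} \<times> {..<n'}"
    using S by (auto simp: S' n' div_le_mono less_Suc_eq_le)
  then have fin': "finite S'" by (rule finite_subset) auto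
  define W where "W a b = {j. \<exists>i. (i, j) \<in> S \<and> i div m = a \<and> j div m = b}" for a b
  define H where "H a b = {i. \<exists>j. (i, j) \<in> S \<and> i div m = a \<and> j div m = b}" for a b
  define X where "X = (SIGMA b:{..<n'}. {a\<in>{..<n'}. q \<le> card (W a b)})"
  define Y where "Y = (SIGMA a:{..<n'}. {b\<in>{..<n'}. q \<le> card (H a b)})"
  have bW: "W a b \<subseteq> {b * m..<b * m + m}" and bH: "H a b \<subseteq> {a * m..<a * m + m}" for a b
    by (auto simp: W_def H_def less_block_end[OF assms(3)])
  have cW: "card (W a b) \<le> m" "finite (W a b)" for a b
    using card_mono[OF _ bW[of a b]] finite_subset[OF bW[of a b]] by auto
  have cH: "card (H a b) \<le> m" "finite (H a b)" for a b
    using card_mono[OF _ bH[of a b]] finite_subset[OF bH[of a b]] by auto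
  have q: "0 < q" using np by (cases q) auto
  have "card {a\<in>{..<n'}. q \<le> card (W a b)} \<le> q * 2 ^ m" for b
  proof -
    have "{a. q \<le> card (W a b)} \<subseteq> (\<lambda>p. fst p div m) ` S"
    proof
      fix a assume "a \<in> {a. q \<le> card (W a b)}"
      then have "W a b \<noteq> {}" using q by auto
      then show "a \<in> (\<lambda>p. fst p div m) ` S" by (force simp: W_def)
    qed
    then have "finite {a. q \<le> card (W a b)}" using fin by (rule finite_surj[rotated])
    then have "card {a\<in>{..<n'}. q \<le> card (W a b)} \<le> card {a. q \<le> card (W a b)}"
      by (rule card_mono) auto
    also have "\<dots> \<le> q * 2 ^ m"
      unfolding W_def by (rule card_wide_blocks[OF fin assms(3) np \<sigma>])
    finally show ?thesis .
  qed
  then have "(\<Sum>b<n'. card {a\<in>{..<n'}. q \<le> card (W a b)}) \<le> (\<Sum>b<n'. q * 2 ^ m)"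
    by (intro sum_mono)
  then have cX: "card X \<le> n' * (q * 2 ^ m)" by (simp add: X_def)
  have "card {b\<in>{..<n'}. q \<le> card (H a b)} \<le> q * 2 ^ m" for a
  proof -
    have "{b. q \<le> card (H a b)} \<subseteq> (\<lambda>p. snd p div m) ` S"
    proof
      fix b assume "b \<in> {b. q \<le> card (H a b)}"
      then have "H a b \<noteq> {}" using q by auto
      then show "b \<in> (\<lambda>p. snd p div m) ` S" by (force simp: H_def)
    qed
    then have "finite {b. q \<le> card (H a b)}" using fin by (rule finite_surj[rotated])
    then have "card {b\<in>{..<n'}. q \<le> card (H a b)} \<le> card {b. q \<le> card (H a b)}"
      by (rule card_mono) auto
    also have "H a b = {i. \<exists>j. (j, i) \<in> S\<inverse> \<and> j div m = b \<and> i div m = a}" for b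
      by (auto simp: H_def)
    then have "card {b. q \<le> card (H a b)} \<le> q * 2 ^ m"
      using card_wide_blocks[OF finc assms(3) npc bij_betw_inv_into[OF \<sigma>], of a] by simp
    finally show ?thesis .
  qed
  then have "(\<Sum>a<n'. card {b\<in>{..<n'}. q \<le> card (H a b)}) \<le> (\<Sum>a<n'. q * 2 ^ m)"
    by (intro sum_mono)
  then have cY: "card Y \<le> n' * (q * 2 ^ m)" by (simp add: Y_def)
  have finX: "finite X" "finite Y" by (auto simp: X_def Y_def)
  \<comment> \<open>Wide blocks were counted per block column, so \<open>X\<close> holds pairs
    (column, row); the swap restores the order (row, column) of \<open>Y\<close>.\<close>
  define Z where "Z = prod.swap ` X \<union> Y"
  have cZ: "card Z \<le> 2 * n' * q * 2 ^ m" "finite Z"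
  proof -
    have "card Z \<le> card (prod.swap ` X) + card Y"
      unfolding Z_def by (rule card_Un_le)
    also have "\<dots> \<le> card X + card Y" using card_image_le[OF finX(1)] by simp
    finally show "card Z \<le> 2 * n' * q * 2 ^ m" using cX cY by (simp add: algebra_simps)
    show "finite Z" using finX by (simp add: Z_def)
  qed
  have block: "{p \<in> S. ?f p = (a, b)} \<subseteq> H a b \<times> W a b" for a b
    by (auto simp: H_def W_def)
  have bd: "card {p \<in> S. ?f p = (a, b)} \<le> card (H a b) * card (W a b)" for a b
    using card_mono[OF _ block[of a b]] cW cH by (simp add: card_cartesian_product)
  have each: "card {p \<in> S. ?f p = B} \<le> q * q + (if B \<in> Z then m * m else 0)" if "B \<in> S'" for B
  proof (cases B)
    case (Pair a b)
    have ab: "a < n'" "b < n'" using that sub' Pair by auto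
    show ?thesis
    proof (cases "B \<in> Z")
      case True
      have "card (H a b) * card (W a b) \<le> m * m" using cH cW by (intro mult_mono) auto
      with bd[of a b] True show ?thesis by (simp add: Pair)
    next
      case False
      then have "card (H a b) < q" "card (W a b) < q"
        using ab by (force simp: Z_def X_def Y_def Pair image_iff)+
      then have "card (H a b) * card (W a b) \<le> q * q" by (intro mult_mono) auto
      with bd[of a b] show ?thesis by (simp add: Pair)
    qed
  qed
  have "card S = (\<Sum>B\<in>S'. card {p \<in> S. ?f p = B})"
    by (rule card_eq_sum_fibres) (use fin fin' S' in auto)
  also have "\<dots> \<le> (\<Sum>B\<in>S'. q * q + (if B \<in> Z then m * m else 0))"
    by (intro sum_mono each)
  also have "\<dots> = q * q * card S' + card (S' \<inter> Z) * (m * m)"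
    using fin' by (simp add: sum.distrib sum.If_cases Int_def)
  also have "\<dots> \<le> q * q * card S' + (2 * n' * q * 2 ^ m) * (m * m)"
  proof -
    have "card (S' \<inter> Z) \<le> card Z" using cZ(2) by (intro card_mono) auto
    then show ?thesis using cZ(1) by (intro add_left_mono mult_right_mono) auto
  qed
  finally show ?thesis .
qed

text \<open>Contracting every block to a point preserves avoidance by
  \<open>has_pattern_map_prod\<close>, so the induction hypothesis bounds the number of nonempty
  blocks.\<close>

theorem Marcus_Tardos:
  fixes S :: "(nat \<times> nat) set"
  assumes \<sigma>: "bij_betw \<sigma> {..<q} {..<q}" and "\<not> has_pattern q \<sigma> S" and "S \<subseteq> {..<n} \<times> {..<n}"
  shows "card S \<le> mt_const q * n"
  using assms(2,3)
proof (induction n arbitrary: S rule: less_induct)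
  case (less n)
  have q: "1 \<le> q" using less.prems(1) by (cases q) auto
  define m where "m = 4 * q * q"
  have qq: "1 \<le> q * q" using q by simp
  then have m: "4 \<le> m" by (simp add: m_def)
  have C: "mt_const q = 2 * q * 2 ^ m * (m * m)" by (simp add: mt_const_def m_def)
  show ?case
  proof (cases "n < m")
    case True
    have "card S \<le> card ({..<n} \<times> {..<n})" using less.prems by (intro card_mono) auto
    also have "\<dots> = n * n" by simp
    also have "\<dots> \<le> m * n" using True by simp
    also have "\<dots> \<le> mt_const q * n"
    proof (rule mult_right_mono)
      have "m * 1 \<le> m * (2 * q * 2 ^ m * m)" using m q by (intro mult_left_mono) auto
      then show "m \<le> mt_const q" by (simp add: C algebra_simps)
    qed simp
    finally show ?thesis .
  next
    case False
    define n' where "n' = n div m + 1"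
    define S' where "S' = map_prod (\<lambda>i. i div m) (\<lambda>j. j div m) ` S"
    \<comment> \<open>\<open>n'\<close> allows for a partial last block, which costs at most another
      \<open>n\<close> because \<open>m \<le> n\<close>.\<close>
    have mn: "m * n' \<le> 2 * n"
      using False by (simp add: n'_def algebra_simps)
        (metis add_mono mult.commute not_less times_div_less_eq_dividend mult_2)
    have n2: "2 * n' \<le> n"
    proof -
      have "4 * n' \<le> m * n'" using m by simp
      with mn show ?thesis by linarith
    qed
    have "n' < n" using n2 by (simp add: n'_def)
    have "S' \<subseteq> {..<n'} \<times> {..<n'}"
      using less.prems(2) by (auto simp: S'_def n'_def div_le_mono less_Suc_eq_le)
    moreover have "\<not> has_pattern q \<sigma> S'"
      using has_pattern_map_prod[OF \<sigma>] less.prems(1) unfolding S'_def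
      by (metis div_le_mono monoI)
    ultimately have IH: "card S' \<le> mt_const q * n'"
      using less.IH[OF \<open>n' < n\<close>] by simp
    have "card S \<le> q * q * card S' + 2 * n' * q * 2 ^ m * (m * m)"
      by (rule card_block_decomposition[OF \<sigma> less.prems(1) _ less.prems(2) n'_def S'_def]) (use m in simp)
    also have "\<dots> \<le> q * q * (mt_const q * n') + 2 * n' * q * 2 ^ m * (m * m)"
      using IH by simp
    also have "\<dots> = mt_const q * (q * q * n' + n')" by (simp add: C algebra_simps)
    also have "\<dots> \<le> mt_const q * n"
    proof (rule mult_left_mono)
      \<comment> \<open>The side \<open>4 * q * q\<close> is chosen so that
        \<open>q * q * n'\<close> and \<open>n'\<close> are both at most half of \<open>n\<close>,
        and the constant reproduces itself.\<close>
      have "4 * (q * q * n') \<le> 2 * n" using mn by (simp add: m_def algebra_simps)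
      then show "q * q * n' + n' \<le> n" using n2 by linarith
    qed simp
    finally show ?thesis .
  qed
qed

text \<open>Ranks inside \<open>R\<close> and \<open>K\<close> compress the index sets to initial
  segments. The rank function is monotone on all numbers and injective on its set, so neither
  avoidance nor cardinality is lost. Deleting lines later leaves such sets with gaps.\<close>

lemma Marcus_Tardos_finite:
  assumes \<sigma>: "bij_betw \<sigma> {..<q} {..<q}" and "\<not> has_pattern q \<sigma> S"
    and S: "S \<subseteq> R \<times> K" and fin: "finite R" "finite K" and le: "card R \<le> n" "card K \<le> n"
  shows "card S \<le> mt_const q * n"
proof -
  define rk where "rk X x = card {y \<in> X. y < x}" for X :: "nat set" and x
  have mono: "mono (rk X)" if "finite X" for X
    unfolding rk_def using that by (intro monoI card_mono) auto
  have less: "rk X x < rk X y" if "finite X" "x \<in> X" "x < y" for X x y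
    unfolding rk_def using that by (intro psubset_card_mono) auto
  have inj: "inj_on (rk X) X" if "finite X" for X
    by (intro inj_onI) (metis less linorder_neq_iff that)
  have lt: "rk X x < card X" if "finite X" "x \<in> X" for X x
    unfolding rk_def using that by (intro psubset_card_mono) auto
  let ?f = "map_prod (rk R) (rk K)"
  have "inj_on ?f (R \<times> K)" using inj fin by (intro map_prod_inj_on) auto
  then have "card (?f ` S) = card S" using S by (meson card_image inj_on_subset)
  moreover have "card (?f ` S) \<le> mt_const q * n"
  proof (rule Marcus_Tardos[OF \<sigma>])
    show "\<not> has_pattern q \<sigma> (?f ` S)"
      using has_pattern_map_prod[OF \<sigma> mono mono] assms(2) fin by blast
    show "?f ` S \<subseteq> {..<n} \<times> {..<n}"
      using S lt[OF fin(1)] lt[OF fin(2)] le by (fastforce intro: less_le_trans)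
  qed
  ultimately show ?thesis by simp
qed

section \<open>Bicliques and exact patterns\<close>

text \<open>Infinite sets have cardinality 0, so for \<open>0 < k\<close> the equations force
  \<open>A\<close> and \<open>B\<close> to be finite. For \<open>k = 0\<close> the empty biclique is
  always present.\<close>

definition biclique_free :: "nat \<Rightarrow> ('a \<times> 'b) set \<Rightarrow> bool" where
  "biclique_free k S \<longleftrightarrow> \<not> (\<exists>A B. card A = k \<and> card B = k \<and> A \<times> B \<subseteq> S)"

lemma biclique_free_pos: "biclique_free k S \<Longrightarrow> 0 < k"
  unfolding biclique_free_def by (metis Sigma_empty1 card.empty empty_subsetI gr0I)

lemma biclique_free_mono: "biclique_free k S \<Longrightarrow> T \<subseteq> S \<Longrightarrow> biclique_free k T"
  unfolding biclique_free_def by blast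

lemma biclique_free_converse: "biclique_free k S \<Longrightarrow> biclique_free k (S\<inverse>)"
  unfolding biclique_free_def by blast

lemma biclique_freeD:
  assumes "biclique_free k S" "finite A" "finite B" "k \<le> card A" "A \<times> B \<subseteq> S"
  shows "card B < k"
proof (rule ccontr)
  assume "\<not> ?thesis"
  then obtain A' B' where "A' \<subseteq> A" "card A' = k" "B' \<subseteq> B" "card B' = k"
    using assms(4) by (metis not_less obtain_subset_with_card_n)
  then show False using assms(1,5) unfolding biclique_free_def by blast
qed

section \<open>Sparse pairs and independent transversals\<close>

text \<open>A factor 8 is lost in the double count of \<open>card_dense_rows\<close>,
  \<open>2 ^ (8 * k)\<close> is the number of neighbourhoods inside \<open>8 * k\<close> rows, and
  \<open>k\<close> columns with equal neighbourhood are wanted.\<close>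

definition sparse_size :: "nat \<Rightarrow> nat" where
  "sparse_size k = 8 * k * 2 ^ (8 * k)"

text \<open>A count in the style of Kovari, Sos and Turan. If \<open>8 * k\<close> rows have density
  at least a quarter, the average column has at least \<open>2 * k\<close> ones in them, hence at
  least one eighth of the columns have \<open>k\<close> or more. By pigeonhole \<open>k\<close> of
  these columns have the same neighbourhood, and together they form a biclique.\<close>

lemma card_dense_rows:
  assumes S: "biclique_free k S" and fin: "finite X" "finite Y" and Y: "sparse_size k \<le> card Y"
  shows "card {x \<in> X. card Y \<le> 4 * card {y \<in> Y. (x, y) \<in> S}} < 8 * k"
proof (rule ccontr)
  assume "\<not> ?thesis"
  then have "8 * k \<le> card {x \<in> X. card Y \<le> 4 * card {y \<in> Y. (x, y) \<in> S}}" by simp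
  from obtain_subset_with_card_n[OF this] obtain X'
    where X': "X' \<subseteq> {x \<in> X. card Y \<le> 4 * card {y \<in> Y. (x, y) \<in> S}}" "card X' = 8 * k"
    by blast
  have k: "0 < k" using S by (rule biclique_free_pos)
  have finX': "finite X'" using X' fin(1) by (auto intro: finite_subset)
  define N where "N y = {x \<in> X'. (x, y) \<in> S}" for y
  define Y' where "Y' = {y \<in> Y. k \<le> card (N y)}"
  have "card X' * card Y = (\<Sum>x\<in>X'. card Y)" by simp
  also have "\<dots> \<le> (\<Sum>x\<in>X'. 4 * card {y \<in> Y. (x, y) \<in> S})"
    using X'(1) by (intro sum_mono) auto
  also have "\<dots> = 4 * (\<Sum>y\<in>Y. card (N y))"
    unfolding sum_distrib_left[symmetric] N_def
    by (subst sum_multicount_gen[OF finX' fin(2)]) auto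
  also have "(\<Sum>y\<in>Y. card (N y)) \<le> (\<Sum>y\<in>Y. k + (if y \<in> Y' then 8 * k else 0))"
  proof (rule sum_mono)
    fix y assume "y \<in> Y"
    have "card (N y) \<le> 8 * k" using card_mono[OF finX', of "N y"] X'(2) by (auto simp: N_def)
    then show "card (N y) \<le> k + (if y \<in> Y' then 8 * k else 0)"
      using \<open>y \<in> Y\<close> by (auto simp: Y'_def)
  qed
  also have "\<dots> = k * card Y + 8 * k * card Y'"
  proof -
    have "Y \<inter> Y' = Y'" by (auto simp: Y'_def)
    then show ?thesis using fin(2) by (simp add: sum.distrib sum.If_cases Int_def[symmetric])
  qed
  finally have "k * card Y \<le> k * (8 * card Y')" using X'(2) by simp
  then have "card Y \<le> 8 * card Y'" using k by simp
  with Y have "8 * (k * 2 ^ (8 * k)) \<le> 8 * card Y'" by (simp only: sparse_size_def mult.assoc)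
  then have large: "k * 2 ^ card X' \<le> card Y'" unfolding X'(2) by linarith
  obtain V where V: "V \<subseteq> X'" "k \<le> card {y \<in> Y'. N y = V}"
    by (rule pigeonhole_subsets[of Y' X' N k]) (use fin finX' large in \<open>auto simp: Y'_def N_def\<close>)
  let ?B = "{y \<in> Y'. N y = V}"
  have "?B \<noteq> {}" using V(2) k by (metis card.empty not_less)
  then have "k \<le> card V" by (auto simp: Y'_def)
  moreover have "V \<times> ?B \<subseteq> S" by (auto simp: N_def)
  moreover have "finite V" "finite ?B" using V(1) finX' fin(2) by (auto simp: Y'_def intro: finite_subset)
  ultimately show False using biclique_freeD[OF S] V(2) by (meson not_less)
qed

text \<open>Greedy choice. For each remaining set fewer than \<open>8 * k\<close> points of
  \<open>X a\<close> are dense towards it as rows, and fewer than \<open>8 * k\<close> as columns.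
  As \<open>card A < 2 ^ card A\<close>, the size of \<open>X a\<close> leaves a point
  \<open>p\<close> that is sparse in both directions towards all sets; its neighbours are then
  discarded.\<close>

lemma independent_transversal:
  fixes S :: "('a \<times> 'a) set"
  assumes "finite A" and S: "biclique_free k S"
    and "\<And>a. a \<in> A \<Longrightarrow> finite (X a)"
    and "\<And>a. a \<in> A \<Longrightarrow> sparse_size k * 2 ^ card A \<le> card (X a)"
  shows "\<exists>f. (\<forall>a\<in>A. f a \<in> X a) \<and> (\<forall>a\<in>A. \<forall>b\<in>A. a \<noteq> b \<longrightarrow> (f a, f b) \<notin> S)"
  using assms(1,3,4)
proof (induction A arbitrary: X rule: finite_induct)
  case empty
  then show ?case by simp
next
  case (insert a A)
  have k: "0 < k" using S by (rule biclique_free_pos)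
  define D where "D b = {x \<in> X a. card (X b) \<le> 4 * card {y \<in> X b. (x, y) \<in> S}}" for b
  define D' where "D' b = {x \<in> X a. card (X b) \<le> 4 * card {y \<in> X b. (x, y) \<in> S\<inverse>}}" for b
  have fin: "finite (X b)" if "b \<in> insert a A" for b using insert.prems(1) that .
  have big: "sparse_size k * 2 ^ card A * 2 \<le> card (X b)" if "b \<in> insert a A" for b
    using insert.prems(2)[OF that] insert.hyps by (simp add: mult.assoc mult.commute)
  have big1: "sparse_size k \<le> card (X b)" if "b \<in> insert a A" for b
  proof -
    have "sparse_size k * 1 \<le> sparse_size k * (2 ^ card A * 2)"
      by (intro mult_left_mono) auto
    also have "\<dots> = sparse_size k * 2 ^ card A * 2" by (rule mult.assoc[symmetric])
    also have "\<dots> \<le> card (X b)" by (rule big[OF that])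
    finally show ?thesis by simp
  qed
  have "card (D b \<union> D' b) \<le> 16 * k" if "b \<in> A" for b
  proof -
    have "card (D b) < 8 * k" "card (D' b) < 8 * k"
      unfolding D_def D'_def
      by (rule card_dense_rows[OF S] card_dense_rows[OF biclique_free_converse[OF S]];
          use fin big1 that in blast)+
    then show ?thesis using card_Un_le[of "D b" "D' b"] by linarith
  qed
  then have "(\<Sum>b\<in>A. card (D b \<union> D' b)) \<le> (\<Sum>b\<in>A. 16 * k)" by (intro sum_mono)
  then have "card (\<Union>b\<in>A. D b \<union> D' b) \<le> 16 * k * card A"
    using card_UN_le[OF insert.hyps(1), of "\<lambda>b. D b \<union> D' b"] by (simp add: algebra_simps)
  also have "\<dots> < 16 * k * 2 ^ card A" using k by simp
  also have "\<dots> = 8 * k * 1 * 2 ^ card A * 2" by simp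
  also have "\<dots> \<le> sparse_size k * 2 ^ card A * 2"
    unfolding sparse_size_def by (intro mult_right_mono mult_left_mono) auto
  also have "\<dots> \<le> card (X a)" by (rule big) simp
  finally have "\<not> X a \<subseteq> (\<Union>b\<in>A. D b \<union> D' b)"
    using card_mono[of "\<Union>b\<in>A. D b \<union> D' b" "X a"] insert.hyps(1) fin[of a]
    by (force simp: D_def D'_def)
  then obtain p where p: "p \<in> X a" "\<And>b. b \<in> A \<Longrightarrow> p \<notin> D b \<and> p \<notin> D' b" by blast
  define X' where "X' b = {y \<in> X b. (p, y) \<notin> S \<and> (y, p) \<notin> S}" for b
  have "\<exists>f. (\<forall>b\<in>A. f b \<in> X' b) \<and> (\<forall>b\<in>A. \<forall>c\<in>A. b \<noteq> c \<longrightarrow> (f b, f c) \<notin> S)"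
  proof (rule insert.IH)
    fix b assume b: "b \<in> A"
    then have fb: "finite (X b)" using fin by simp
    then show "finite (X' b)" by (simp add: X'_def)
    have "X b \<subseteq> X' b \<union> ({y \<in> X b. (p, y) \<in> S} \<union> {y \<in> X b. (p, y) \<in> S\<inverse>})"
      by (auto simp: X'_def)
    then have "card (X b) \<le> card (X' b \<union> ({y \<in> X b. (p, y) \<in> S} \<union> {y \<in> X b. (p, y) \<in> S\<inverse>}))"
      using fb by (intro card_mono) (auto simp: X'_def)
    also have "\<dots> \<le> card (X' b) + (card {y \<in> X b. (p, y) \<in> S} + card {y \<in> X b. (p, y) \<in> S\<inverse>})"
      by (meson card_Un_le add_left_mono order_trans)
    \<comment> \<open>Less than a quarter of \<open>X b\<close> is lost in each direction, so at
      least half survives. This uses up one factor 2 of the assumed size.\<close>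
    finally have "card (X b) \<le> 2 * card (X' b)"
      using p(2)[OF b] p(1) by (auto simp: D_def D'_def)
    then show "sparse_size k * 2 ^ card A \<le> card (X' b)"
      using big[of b] b by simp
  qed
  then obtain f where f: "\<forall>b\<in>A. f b \<in> X' b" "\<forall>b\<in>A. \<forall>c\<in>A. b \<noteq> c \<longrightarrow> (f b, f c) \<notin> S" by blast
  show ?case
    by (rule exI[of _ "f(a := p)"]) (use f p(1) insert.hyps(2) in \<open>auto simp: X'_def\<close>)
qed

section \<open>Inflated permutations and exact occurrences\<close>

definition inflate :: "nat \<Rightarrow> (nat \<Rightarrow> nat) \<Rightarrow> nat \<Rightarrow> nat" where
  "inflate N \<pi> i = \<pi> (i div N) * N + i mod N"

lemma less_block_mult: "a < s \<Longrightarrow> x < a * N + N \<Longrightarrow> x < s * N" for a :: nat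
proof -
  assume "a < s" "x < a * N + N"
  then have "x < Suc a * N" by simp
  also have "\<dots> \<le> s * N" using \<open>a < s\<close> by (intro mult_right_mono) auto
  finally show ?thesis .
qed

lemma bij_betw_inflate:
  assumes "bij_betw \<pi> {..<s} {..<s}"
  shows "bij_betw (inflate N \<pi>) {..<s * N} {..<s * N}"
proof (cases "N = 0")
  case False
  then have N: "0 < N" by simp
  have div: "i div N < s" if "i < s * N" for i using that N by (simp add: less_mult_imp_div_less)
  have into: "inflate N \<pi> ` {..<s * N} \<subseteq> {..<s * N}"
  proof
    fix x assume "x \<in> inflate N \<pi> ` {..<s * N}"
    then obtain i where i: "i < s * N" "x = \<pi> (i div N) * N + i mod N" by (auto simp: inflate_def)
    have "\<pi> (i div N) < s" using assms div[OF i(1)] by (auto simp: bij_betw_def)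
    then show "x \<in> {..<s * N}" using less_block_mult[of _ s x N] N i(2) by simp
  qed
  have "inj_on (inflate N \<pi>) {..<s * N}"
  proof (rule inj_onI)
    fix i j assume ij: "i \<in> {..<s * N}" "j \<in> {..<s * N}" "inflate N \<pi> i = inflate N \<pi> j"
    have "inflate N \<pi> i div N = \<pi> (i div N)" "inflate N \<pi> i mod N = i mod N" for i
      using N by (simp_all add: inflate_def)
    then have "\<pi> (i div N) = \<pi> (j div N)" "i mod N = j mod N" using ij(3) by metis+
    moreover have "i div N = j div N"
      using calculation(1) assms div ij(1,2) by (auto simp: bij_betw_def dest: inj_onD)
    ultimately show "i = j" by (metis div_mult_mod_eq)
  qed
  then show ?thesis using into by (simp add: bij_betw_def endo_inj_surj)
qed (simp add: bij_betw_def)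

text \<open>The size that \<open>independent_transversal\<close> demands of each of \<open>s\<close>
  blocks.\<close>

definition blow_up :: "nat \<Rightarrow> nat \<Rightarrow> nat" where
  "blow_up s k = sparse_size k * 2 ^ s"

text \<open>\<^const>\<open>has_pattern\<close> asks only for the ones of a permutation matrix. Choosing one point in each
  block of an inflated permutation turns the remaining entries into zeros.\<close>

lemma exact_pattern:
  assumes \<pi>: "bij_betw \<pi> {..<s} {..<s}" and S: "biclique_free k S"
    and "has_pattern (s * blow_up s k) (inflate (blow_up s k) \<pi>) S"
  shows "\<exists>r c. strict_mono_on {..<s} r \<and> strict_mono_on {..<s} c \<and>
    (\<forall>a<s. \<forall>b<s. (r a, c b) \<in> S \<longleftrightarrow> b = \<pi> a)"
proof -
  define N where "N = blow_up s k"
  define q where "q = s * N"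
  define \<sigma> where "\<sigma> = inflate N \<pi>"
  have N: "0 < N" using biclique_free_pos[OF S] by (simp add: N_def blow_up_def sparse_size_def)
  have \<sigma>: "bij_betw \<sigma> {..<q} {..<q}" unfolding \<sigma>_def q_def by (rule bij_betw_inflate[OF \<pi>])
  then have \<sigma>q: "\<sigma> i < q" if "i < q" for i using that by (auto simp: bij_betw_def)
  from assms(3) obtain r c where rc: "strict_mono_on {..<q} r" "strict_mono_on {..<q} c"
    "\<And>i. i < q \<Longrightarrow> (r i, c (\<sigma> i)) \<in> S"
    unfolding has_pattern_def N_def[symmetric] q_def[symmetric] \<sigma>_def[symmetric] by blast
  \<comment> \<open>\<open>T\<close> relates positions of the inflated permutation: the row of point
    \<open>i\<close> meets the column of point \<open>j\<close> in a one. A biclique in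
    \<open>T\<close> maps to one in \<open>S\<close>, since \<open>r\<close> and
    \<open>c \<circ> \<sigma>\<close> are injective. A transversal independent in \<open>T\<close>
    has zeros at all crossings of different points.\<close>
  define T where "T = {(i, j). i < q \<and> j < q \<and> (r i, c (\<sigma> j)) \<in> S}"
  have inj: "inj_on r {..<q}" "inj_on (c \<circ> \<sigma>) {..<q}"
    using rc(1,2) \<sigma> by (auto simp: strict_mono_on_imp_inj_on bij_betw_def intro!: comp_inj_on)
  have "biclique_free k T"
    unfolding biclique_free_def
  proof (intro notI, elim exE conjE)
    fix A B assume AB: "card A = k" "card B = k" "A \<times> B \<subseteq> T"
    then have ne: "A \<noteq> {}" "B \<noteq> {}" using biclique_free_pos[OF S] by auto
    have sub: "A \<subseteq> {..<q}" "B \<subseteq> {..<q}" using AB(3) ne by (auto simp: T_def)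
    have "card (r ` A) = k" "card ((c \<circ> \<sigma>) ` B) = k"
      using AB card_image inj_on_subset[OF inj(1) sub(1)] inj_on_subset[OF inj(2) sub(2)] by metis+
    moreover have "(r ` A) \<times> ((c \<circ> \<sigma>) ` B) \<subseteq> S" using AB(3) by (auto simp: T_def)
    ultimately show False using S unfolding biclique_free_def by blast
  qed
  then have "\<exists>f. (\<forall>a\<in>{..<s}. f a \<in> {a * N..<a * N + N}) \<and>
      (\<forall>a\<in>{..<s}. \<forall>b\<in>{..<s}. a \<noteq> b \<longrightarrow> (f a, f b) \<notin> T)"
    by (intro independent_transversal[of _ k]) (auto simp: N_def blow_up_def)
  then obtain f where "\<forall>a\<in>{..<s}. f a \<in> {a * N..<a * N + N}"
    "\<forall>a\<in>{..<s}. \<forall>b\<in>{..<s}. a \<noteq> b \<longrightarrow> (f a, f b) \<notin> T" by blast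
  then have f: "\<And>a. a < s \<Longrightarrow> a * N \<le> f a \<and> f a < a * N + N"
    and fT: "\<And>a b. a < s \<Longrightarrow> b < s \<Longrightarrow> a \<noteq> b \<Longrightarrow> (f a, f b) \<notin> T"
    by auto
  have fq: "f a < q" if "a < s" for a
    unfolding q_def by (rule less_block_mult[OF that]) (use f[OF that] in simp)
  have fdiv: "f a div N = a" if "a < s" for a
    using f[OF that] N by (intro div_nat_eqI) (auto simp: mult.commute)
  define \<tau> where "\<tau> = inv_into {..<s} \<pi>"
  have \<tau>: "\<tau> b < s" "\<pi> (\<tau> b) = b" if "b < s" for b
    using that \<pi> inv_into_into[of b \<pi> "{..<s}"] f_inv_into_f[of b \<pi> "{..<s}"]
    by (auto simp: \<tau>_def bij_betw_def)
  have \<tau>\<pi>: "\<tau> (\<pi> a) = a" "\<pi> a < s" if "a < s" for a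
    using that \<pi> by (auto simp: \<tau>_def bij_betw_def)
  have block: "x < y" if "x div N < y div N" for x y using that by (meson div_le_mono not_le)
  have \<sigma>div: "\<sigma> (f a) div N = \<pi> a" if "a < s" for a
    using fdiv[OF that] N by (simp add: \<sigma>_def inflate_def)
  \<comment> \<open>The one in column \<open>b\<close> of the small permutation stands in row
    \<open>\<tau> b\<close>, so column \<open>b\<close> of the occurrence is taken from the point
    chosen in block \<open>\<tau> b\<close>.\<close>
  have iff: "(r (f a), c (\<sigma> (f (\<tau> b)))) \<in> S \<longleftrightarrow> b = \<pi> a" if "a < s" "b < s" for a b
  proof (cases "b = \<pi> a")
    case True
    then show ?thesis using rc(3)[OF fq[OF that(1)]] \<tau>\<pi> that by simp
  next
    case False
    then have "a \<noteq> \<tau> b" using \<tau> that by auto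
    then have "(f a, f (\<tau> b)) \<notin> T" using fT \<tau> that by simp
    then show ?thesis using False fq \<tau> that by (simp add: T_def)
  qed
  have "strict_mono_on {..<s} (\<lambda>a. r (f a))"
  proof (rule strict_mono_onI)
    fix a a' assume a: "a \<in> {..<s}" "a' \<in> {..<s}" "a < a'"
    then have "f a div N < f a' div N" by (simp add: fdiv)
    then have "f a < f a'" by (rule block)
    then show "r (f a) < r (f a')"
      using a fq by (intro strict_mono_onD[OF rc(1)]) auto
  qed
  moreover have "strict_mono_on {..<s} (\<lambda>b. c (\<sigma> (f (\<tau> b))))"
  proof (rule strict_mono_onI)
    fix b b' assume b: "b \<in> {..<s}" "b' \<in> {..<s}" "b < b'"
    then have "\<sigma> (f (\<tau> b)) div N < \<sigma> (f (\<tau> b')) div N" using \<tau> \<sigma>div by simp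
    then have "\<sigma> (f (\<tau> b)) < \<sigma> (f (\<tau> b'))" by (rule block)
    then show "c (\<sigma> (f (\<tau> b))) < c (\<sigma> (f (\<tau> b')))"
      using b \<tau> fq \<sigma>q by (intro strict_mono_onD[OF rc(2)]) auto
  qed
  ultimately show ?thesis using iff by blast
qed

section \<open>Degeneracy and the number of row sets\<close>

text \<open>Otherwise, counting ones along the larger of the two sides gives more than the
  Marcus-Tardos bound for a square of that side.\<close>

lemma low_degree_vertex:
  assumes \<sigma>: "bij_betw \<sigma> {..<q} {..<q}" and np: "\<not> has_pattern q \<sigma> (E \<inter> R \<times> K)"
    and fin: "finite R" "finite K" and ne: "R \<noteq> {} \<or> K \<noteq> {}"
  shows "(\<exists>i\<in>R. card {j \<in> K. (i, j) \<in> E} \<le> mt_const q) \<or>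
    (\<exists>j\<in>K. card {i \<in> R. (i, j) \<in> E} \<le> mt_const q)"
proof (rule ccontr)
  assume "\<not> ?thesis"
  then have deg: "\<And>i. i \<in> R \<Longrightarrow> mt_const q + 1 \<le> card {j \<in> K. (i, j) \<in> E}"
    "\<And>j. j \<in> K \<Longrightarrow> mt_const q + 1 \<le> card {i \<in> R. (i, j) \<in> E}" by force+
  have finS: "finite (E \<inter> R \<times> K)" using fin by simp
  have "card (E \<inter> R \<times> K) = (\<Sum>i\<in>R. card {p \<in> E \<inter> R \<times> K. fst p = i})"
    by (rule card_eq_sum_fibres) (use fin in auto)
  also have "\<dots> = (\<Sum>i\<in>R. card {j \<in> K. (i, j) \<in> E})"
  proof (rule sum.cong)
    fix i assume "i \<in> R"
    then have "{p \<in> E \<inter> R \<times> K. fst p = i} = Pair i ` {j \<in> K. (i, j) \<in> E}" by auto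
    then show "card {p \<in> E \<inter> R \<times> K. fst p = i} = card {j \<in> K. (i, j) \<in> E}"
      by (simp add: card_image inj_on_def)
  qed simp
  also have "\<dots> \<ge> (\<Sum>i\<in>R. mt_const q + 1)" by (intro sum_mono deg)
  finally have r: "(mt_const q + 1) * card R \<le> card (E \<inter> R \<times> K)" by (simp add: mult.commute)
  have "card (E \<inter> R \<times> K) = (\<Sum>j\<in>K. card {p \<in> E \<inter> R \<times> K. snd p = j})"
    by (rule card_eq_sum_fibres) (use fin in auto)
  also have "\<dots> = (\<Sum>j\<in>K. card {i \<in> R. (i, j) \<in> E})"
  proof (rule sum.cong)
    fix j assume "j \<in> K"
    then have "{p \<in> E \<inter> R \<times> K. snd p = j} = (\<lambda>i. (i, j)) ` {i \<in> R. (i, j) \<in> E}" by auto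
    then show "card {p \<in> E \<inter> R \<times> K. snd p = j} = card {i \<in> R. (i, j) \<in> E}"
      by (simp add: card_image inj_on_def)
  qed simp
  also have "\<dots> \<ge> (\<Sum>j\<in>K. mt_const q + 1)" by (intro sum_mono deg)
  finally have c: "(mt_const q + 1) * card K \<le> card (E \<inter> R \<times> K)" by (simp add: mult.commute)
  define n where "n = max (card R) (card K)"
  have "card (E \<inter> R \<times> K) \<le> mt_const q * n"
    by (rule Marcus_Tardos_finite[OF \<sigma> np _ fin]) (auto simp: n_def)
  moreover have "(mt_const q + 1) * n \<le> card (E \<inter> R \<times> K)" using r c by (simp add: n_def max_def)
  moreover have "0 < n" using ne fin by (auto simp: n_def card_gt_0_iff less_max_iff_disj)
  ultimately show False by simp
qed

definition common :: "('a \<times> 'b) set \<Rightarrow> 'b set \<Rightarrow> 'a set \<Rightarrow> 'b set" where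
  "common E K S = {j \<in> K. \<forall>i\<in>S. (i, j) \<in> E}"

text \<open>Deleting a vertex of degree at most \<open>d\<close> destroys at most \<open>2 ^ (d + k)\<close> sets: if it is a
  column, these are sets of its neighbours; if it is a row, each is a subset of the fewer than \<open>k\<close>
  common neighbours of one of the \<open>k\<close>-sets of neighbours of that row.\<close>

lemma card_row_sets:
  fixes E :: "('a \<times> 'b) set"
  assumes "finite R" "finite K" and free: "biclique_free k (E \<inter> R \<times> K)"
    and low: "\<And>R' K'. R' \<subseteq> R \<Longrightarrow> K' \<subseteq> K \<Longrightarrow> R' \<noteq> {} \<or> K' \<noteq> {} \<Longrightarrow>
      (\<exists>i\<in>R'. card {j \<in> K'. (i, j) \<in> E} \<le> d) \<or> (\<exists>j\<in>K'. card {i \<in> R'. (i, j) \<in> E} \<le> d)"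
  shows "card {S. S \<subseteq> R \<and> S \<noteq> {} \<and> k \<le> card (common E K S)} \<le> (card R + card K) * 2 ^ (d + k)"
  using assms
proof (induction "card R + card K" arbitrary: R K)
  case 0
  then have "R = {}" by simp
  then have "{S. S \<subseteq> R \<and> S \<noteq> {} \<and> k \<le> card (common E K S)} = {}" by blast
  then show ?case by (metis card.empty le0)
next
  case (Suc n)
  let ?F = "\<lambda>R K. {S. S \<subseteq> R \<and> S \<noteq> {} \<and> k \<le> card (common E K S)}"
  have fin: "finite R" "finite K" by fact+
  have pow: "2 ^ m \<le> (2::nat) ^ (d + k)" if "m \<le> d \<or> m \<le> k" for m
    using that by (intro power_increasing) auto
  have "R \<noteq> {} \<or> K \<noteq> {}" using Suc.hyps(2) by auto
  then consider (row) x where "x \<in> R" "card {j \<in> K. (x, j) \<in> E} \<le> d"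
    | (col) x where "x \<in> K" "card {i \<in> R. (i, x) \<in> E} \<le> d"
    using Suc.prems(4)[of R K] by blast
  then show ?case
  proof cases
    case row
    define R' where "R' = R - {x}"
    have cR: "card R = Suc (card R')" using card.remove[OF fin(1) row(1)] by (simp add: R'_def)
    have IH: "card (?F R' K) \<le> (card R' + card K) * 2 ^ (d + k)"
    proof (rule Suc.hyps(1))
      show "biclique_free k (E \<inter> R' \<times> K)"
        using Suc.prems(3) by (rule biclique_free_mono) (auto simp: R'_def)
      show "(\<exists>i\<in>A. card {j \<in> B. (i, j) \<in> E} \<le> d) \<or> (\<exists>j\<in>B. card {i \<in> A. (i, j) \<in> E} \<le> d)"
        if "A \<subseteq> R'" "B \<subseteq> K" "A \<noteq> {} \<or> B \<noteq> {}" for A B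
        using that by (intro Suc.prems(4)) (auto simp: R'_def)
    qed (use Suc.hyps(2) fin cR in \<open>auto simp: R'_def\<close>)
    define N where "N = {j \<in> K. (x, j) \<in> E}"
    define G where "G T = {S. S \<subseteq> {i \<in> R. \<forall>j\<in>T. (i, j) \<in> E}}" for T
    have finN: "finite N" using fin by (simp add: N_def)
    let ?TT = "{T. T \<subseteq> N \<and> card T = k}"
    have "?F R K \<subseteq> ?F R' K \<union> (\<Union>T\<in>?TT. G T)"
    proof
      fix S assume S: "S \<in> ?F R K"
      show "S \<in> ?F R' K \<union> (\<Union>T\<in>?TT. G T)"
      proof (cases "x \<in> S")
        case True
        obtain T where T: "T \<subseteq> common E K S" "card T = k"
          using S by (metis (no_types, lifting) mem_Collect_eq obtain_subset_with_card_n)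
        then have "T \<in> ?TT" "S \<in> G T" using S True by (auto simp: N_def G_def common_def)
        then show ?thesis by blast
      qed (use S in \<open>auto simp: R'_def\<close>)
    qed
    then have "card (?F R K) \<le> card (?F R' K \<union> (\<Union>T\<in>?TT. G T))"
      using fin finN by (intro card_mono) (auto simp: R'_def G_def)
    also have "\<dots> \<le> card (?F R' K) + card (\<Union>T\<in>?TT. G T)" by (rule card_Un_le)
    also have "card (\<Union>T\<in>?TT. G T) \<le> (\<Sum>T\<in>?TT. card (G T))"
      using finN by (intro card_UN_le) auto
    also have "\<dots> \<le> (\<Sum>T\<in>?TT. 2 ^ k)"
    proof (rule sum_mono)
      fix T assume T: "T \<in> ?TT"
      let ?B = "{i \<in> R. \<forall>j\<in>T. (i, j) \<in> E}"
      have "card ?B < k"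
        by (rule biclique_freeD[OF biclique_free_converse[OF Suc.prems(3)], of T])
          (use T finN fin in \<open>auto simp: N_def intro: finite_subset\<close>)
      then have "2 ^ card ?B \<le> (2::nat) ^ k" by (intro power_increasing) auto
      then show "card (G T) \<le> 2 ^ k" using fin by (simp add: G_def Pow_def[symmetric] card_Pow)
    qed
    also have "\<dots> \<le> 2 ^ d * 2 ^ k"
    proof -
      have "card ?TT \<le> card (Pow N)" using finN by (intro card_mono) auto
      also have "\<dots> \<le> 2 ^ d" using row(2) finN by (simp add: card_Pow N_def[symmetric])
      finally show ?thesis by simp
    qed
    finally show ?thesis using IH by (simp add: cR power_add)
  next
    case col
    define K' where "K' = K - {x}"
    have cK: "card K = Suc (card K')" using card.remove[OF fin(2) col(1)] by (simp add: K'_def)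
    have IH: "card (?F R K') \<le> (card R + card K') * 2 ^ (d + k)"
    proof (rule Suc.hyps(1))
      show "biclique_free k (E \<inter> R \<times> K')"
        using Suc.prems(3) by (rule biclique_free_mono) (auto simp: K'_def)
      show "(\<exists>i\<in>A. card {j \<in> B. (i, j) \<in> E} \<le> d) \<or> (\<exists>j\<in>B. card {i \<in> A. (i, j) \<in> E} \<le> d)"
        if "A \<subseteq> R" "B \<subseteq> K'" "A \<noteq> {} \<or> B \<noteq> {}" for A B
        using that by (intro Suc.prems(4)) (auto simp: K'_def)
    qed (use Suc.hyps(2) fin cK in \<open>auto simp: K'_def\<close>)
    define N where "N = {i \<in> R. (i, x) \<in> E}"
    have "?F R K \<subseteq> ?F R K' \<union> Pow N"
    proof
      fix S assume S: "S \<in> ?F R K"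
      show "S \<in> ?F R K' \<union> Pow N"
      proof (cases "x \<in> common E K S")
        case True
        then show ?thesis using S by (auto simp: common_def N_def)
      next
        case False
        then have "common E K' S = common E K S" by (auto simp: common_def K'_def)
        then show ?thesis using S by simp
      qed
    qed
    then have "card (?F R K) \<le> card (?F R K' \<union> Pow N)"
      using fin by (intro card_mono) (auto simp: N_def)
    also have "\<dots> \<le> card (?F R K') + card (Pow N)" by (rule card_Un_le)
    also have "card (Pow N) \<le> 2 ^ (d + k)"
      using fin col(2) pow[of "card N"] by (simp add: card_Pow N_def)
    finally show ?thesis using IH by (simp add: cK)
  qed
qed

section \<open>From sets of positions to matrices\<close>

definition ones :: "nat mat \<Rightarrow> (nat \<times> nat) set" where
  "ones M = {(i, j). i < dim_row M \<and> j < dim_col M \<and> M $$ (i, j) = 1}"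

lemma pick_image_strict_mono:
  assumes "strict_mono_on {..<k} r" "a < k"
  shows "pick (r ` {..<k}) a = r a"
proof -
  have "{x \<in> r ` {..<k}. x < r a} = r ` {..<a}"
    using assms by (auto simp: strict_mono_on_less)
  moreover have "inj_on r {..<a}"
    using strict_mono_on_imp_inj_on[OF assms(1)] assms(2) by (auto intro: inj_on_subset)
  ultimately have "card {x \<in> r ` {..<k}. x < r a} = a" by (simp add: card_image)
  then show ?thesis using pick_card_in_set[of "r a" "r ` {..<k}"] assms(2) by auto
qed

text \<open>Translates the increasing index maps found by \<open>exact_pattern\<close> into the
  index sets expected by \<open>submatrix\<close>.\<close>

lemma submatrix_strict_mono:
  assumes r: "strict_mono_on {..<m} r" "r ` {..<m} \<subseteq> {..<dim_row A}"
    and c: "strict_mono_on {..<n} c" "c ` {..<n} \<subseteq> {..<dim_col A}"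
  shows "submatrix A (r ` {..<m}) (c ` {..<n}) = mat m n (\<lambda>(i, j). A $$ (r i, c j))"
proof -
  have "{i. i < dim_row A \<and> i \<in> r ` {..<m}} = r ` {..<m}"
    "{j. j < dim_col A \<and> j \<in> c ` {..<n}} = c ` {..<n}" using r(2) c(2) by auto
  then show ?thesis
    using strict_mono_on_imp_inj_on[OF r(1)] strict_mono_on_imp_inj_on[OF c(1)]
    by (intro eq_matI) (auto simp: submatrix_def card_image pick_image_strict_mono r(1) c(1))
qed

lemma has_biclique_iff:
  "has_biclique M k \<longleftrightarrow> (\<exists>A B. card A = k \<and> card B = k \<and> A \<subseteq> {..<dim_row M} \<and>
     B \<subseteq> {..<dim_col M} \<and> A \<times> B \<subseteq> ones M)"
proof
  assume "has_biclique M k"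
  then obtain I J where IJ: "submatrix M I J = mat k k (\<lambda>_. 1)" by (auto simp: has_biclique_def)
  define A where "A = {i. i < dim_row M \<and> i \<in> I}"
  define B where "B = {j. j < dim_col M \<and> j \<in> J}"
  have card: "card A = k" "card B = k"
    using arg_cong[OF IJ, of dim_row] arg_cong[OF IJ, of dim_col]
    by (simp_all add: dim_submatrix A_def B_def)
  have "(i, j) \<in> ones M" if "i \<in> A" "j \<in> B" for i j
  proof -
    have ij: "i < dim_row M" "i \<in> I" "j < dim_col M" "j \<in> J" using that by (auto simp: A_def B_def)
    have "card {a \<in> I. a < i} < card A" "card {a \<in> J. a < j} < card B"
      using that by (intro psubset_card_mono; auto simp: A_def B_def)+
    then have "submatrix M I J $$ (card {a \<in> I. a < i}, card {a \<in> J. a < j}) = 1"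
      unfolding IJ card by simp
    then show ?thesis using submatrix_index_card[OF ij(1,3,2,4)] ij by (simp add: ones_def)
  qed
  then show "\<exists>A B. card A = k \<and> card B = k \<and> A \<subseteq> {..<dim_row M} \<and>
     B \<subseteq> {..<dim_col M} \<and> A \<times> B \<subseteq> ones M"
    using card by (intro exI[of _ A] exI[of _ B]) (auto simp: A_def B_def)
next
  assume "\<exists>A B. card A = k \<and> card B = k \<and> A \<subseteq> {..<dim_row M} \<and>
     B \<subseteq> {..<dim_col M} \<and> A \<times> B \<subseteq> ones M"
  then obtain A B where AB: "card A = k" "card B = k" "A \<subseteq> {..<dim_row M}"
    "B \<subseteq> {..<dim_col M}" "A \<times> B \<subseteq> ones M" by blast
  have pick: "pick A i \<in> A" "pick B i \<in> B" if "i < k" for i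
    using AB(1,2) that by (auto intro: pick_in_set_le)
  have "submatrix M (pick A ` {..<k}) (pick B ` {..<k}) = mat k k (\<lambda>(i, j). M $$ (pick A i, pick B j))"
  proof (rule submatrix_strict_mono)
    show "strict_mono_on {..<k} (pick A)" "strict_mono_on {..<k} (pick B)"
      using AB(1,2) by (simp_all add: strict_mono_on_pick)
    show "pick A ` {..<k} \<subseteq> {..<dim_row M}" "pick B ` {..<k} \<subseteq> {..<dim_col M}"
      using pick AB(3,4) by blast+
  qed
  also have "\<dots> = mat k k (\<lambda>_. 1)"
  proof (rule cong_mat)
    fix i j assume "i < k" "j < k"
    then have "(pick A i, pick B j) \<in> ones M" using AB(5) pick by blast
    then show "(\<lambda>(i, j). M $$ (pick A i, pick B j)) (i, j) = (\<lambda>_. 1) (i, j)" by (simp add: ones_def)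
  qed auto
  finally show "has_biclique M k" unfolding has_biclique_def by blast
qed

lemma permutation_matE:
  assumes "permutation_mat P"
  obtains \<pi> where "bij_betw \<pi> {..<dim_row P} {..<dim_row P}"
    "P = mat (dim_row P) (dim_row P) (\<lambda>(a, b). if b = \<pi> a then 1 else 0)"
proof -
  let ?s = "dim_row P"
  have sq: "dim_col P = ?s" using assms by (simp add: permutation_mat_def)
  have zo: "\<And>a b. a < ?s \<Longrightarrow> b < ?s \<Longrightarrow> P $$ (a, b) \<in> {0, 1}"
    and row: "\<And>a. a < ?s \<Longrightarrow> \<exists>!b. b < ?s \<and> P $$ (a, b) = 1"
    and col: "\<And>b. b < ?s \<Longrightarrow> \<exists>!a. a < ?s \<and> P $$ (a, b) = 1"
    using assms unfolding permutation_mat_def zero_one_mat_def sq by blast+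
  have "\<forall>a. \<exists>b. a < ?s \<longrightarrow> b < ?s \<and> P $$ (a, b) = 1" using row by blast
  from choice[OF this] obtain \<pi>
    where \<pi>: "\<And>a. a < ?s \<Longrightarrow> \<pi> a < ?s \<and> P $$ (a, \<pi> a) = 1" by blast
  have inj: "inj_on \<pi> {..<?s}"
  proof (intro inj_onI)
    fix a a' assume "a \<in> {..<?s}" "a' \<in> {..<?s}" "\<pi> a = \<pi> a'"
    then show "a = a'" using \<pi>[of a] \<pi>[of a'] col[of "\<pi> a"] by auto
  qed
  have "\<pi> ` {..<?s} \<subseteq> {..<?s}" using \<pi> by auto
  from endo_inj_surj[OF _ this inj] have "bij_betw \<pi> {..<?s} {..<?s}"
    using inj by (simp add: bij_betw_def)
  moreover have "P = mat ?s ?s (\<lambda>(a, b). if b = \<pi> a then 1 else 0)"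
  proof (rule eq_matI)
    fix a b assume "a < dim_row (mat ?s ?s (\<lambda>(a, b). if b = \<pi> a then 1 else (0::nat)))"
      "b < dim_col (mat ?s ?s (\<lambda>(a, b). if b = \<pi> a then 1 else (0::nat)))"
    then have ab: "a < ?s" "b < ?s" by auto
    have "P $$ (a, b) = 1 \<longleftrightarrow> b = \<pi> a" using row[OF ab(1)] \<pi>[OF ab(1)] ab(2) by blast
    then show "P $$ (a, b) = mat ?s ?s (\<lambda>(a, b). if b = \<pi> a then 1 else 0) $$ (a, b)"
      using zo[OF ab] ab by auto
  qed (use sq in auto)
  ultimately show ?thesis by (rule that)
qed

text \<open>This is \<open>2 ^ (d + k)\<close>, where \<open>d\<close> is the degree bound for the
  inflated permutation; the class enters only through the size \<open>s\<close> of its missing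
  permutation matrix.\<close>

definition sets_bound :: "nat \<Rightarrow> nat \<Rightarrow> nat" where
  "sets_bound s k = 2 ^ (mt_const (s * blow_up s k) + k)"

text \<open>Freeness is assumed for the first \<open>m\<close> rows only, since the bound is applied
  to the rows read so far. An occurrence of the inflated pattern in any part
  \<open>R \<times> K\<close> would yield \<open>P\<close> as a submatrix of \<open>M\<close>, so
  every part has a line with few ones.\<close>

lemma card_row_sets_class:
  assumes cls: "matrix_class \<M>" and zo: "\<forall>M \<in> \<M>. zero_one_mat M"
    and P: "permutation_mat P" "P \<notin> \<M>" and M: "M \<in> \<M>" "m \<le> dim_row M"
    and free: "biclique_free k (ones M \<inter> {..<m} \<times> {..<dim_col M})"
  shows "card {S. S \<subseteq> {..<m} \<and> S \<noteq> {} \<and> k \<le> card (common (ones M) {..<dim_col M} S)}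
    \<le> (m + dim_col M) * sets_bound (dim_row P) k"
proof -
  let ?s = "dim_row P"
  obtain \<pi> where \<pi>: "bij_betw \<pi> {..<?s} {..<?s}"
    "P = mat ?s ?s (\<lambda>(a, b). if b = \<pi> a then 1 else 0)"
    using P(1) by (rule permutation_matE)
  define N where "N = blow_up ?s k"
  define q where "q = ?s * N"
  have \<sigma>: "bij_betw (inflate N \<pi>) {..<q} {..<q}" unfolding q_def by (rule bij_betw_inflate[OF \<pi>(1)])
  have no_pattern: "\<not> has_pattern q (inflate N \<pi>) (ones M \<inter> R \<times> K)"
    if RK: "R \<subseteq> {..<m}" "K \<subseteq> {..<dim_col M}" for R K
  proof
    assume pat: "has_pattern q (inflate N \<pi>) (ones M \<inter> R \<times> K)"
    have "biclique_free k (ones M \<inter> R \<times> K)"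
      using free by (rule biclique_free_mono) (use RK in auto)
    from exact_pattern[OF \<pi>(1) this pat[unfolded q_def N_def]] obtain r c
      where rc: "strict_mono_on {..<?s} r" "strict_mono_on {..<?s} c"
        "\<And>a b. a < ?s \<Longrightarrow> b < ?s \<Longrightarrow> (r a, c b) \<in> ones M \<inter> R \<times> K \<longleftrightarrow> b = \<pi> a"
      by blast
    have \<pi>s: "\<pi> a < ?s" if "a < ?s" for a using that \<pi>(1) by (auto simp: bij_betw_def)
    have rR: "r a \<in> R" if "a < ?s" for a using rc(3)[OF that \<pi>s[OF that]] by blast
    have cK: "c b \<in> K" if "b < ?s" for b
    proof -
      have "b \<in> \<pi> ` {..<?s}" using \<pi>(1) that by (simp add: bij_betw_def)
      then obtain a where "a < ?s" "\<pi> a = b" by blast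
      then show ?thesis using rc(3)[of a b] that by blast
    qed
    have "submatrix M (r ` {..<?s}) (c ` {..<?s}) = mat ?s ?s (\<lambda>(a, b). M $$ (r a, c b))"
      by (rule submatrix_strict_mono[OF rc(1) _ rc(2)]) (use rR cK RK M(2) in fastforce)+
    also have "\<dots> = mat ?s ?s (\<lambda>(a, b). if b = \<pi> a then 1 else 0)"
    proof (rule cong_mat)
      fix a b assume ab: "a < ?s" "b < ?s"
      have lt: "r a < dim_row M" "c b < dim_col M" using rR[OF ab(1)] cK[OF ab(2)] RK M(2) by auto
      \<comment> \<open>\<open>ones\<close> determines an entry only if all entries are 0 or
        1.\<close>
      then have "M $$ (r a, c b) \<in> {0, 1}" using zo M(1) by (simp add: zero_one_mat_def)
      moreover have "M $$ (r a, c b) = 1 \<longleftrightarrow> b = \<pi> a"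
        using rc(3)[OF ab] rR[OF ab(1)] cK[OF ab(2)] lt by (simp add: ones_def)
      ultimately show "(\<lambda>(a, b). M $$ (r a, c b)) (a, b) = (\<lambda>(a, b). if b = \<pi> a then 1 else 0) (a, b)"
        by auto
    qed auto
    finally have "submatrix M (r ` {..<?s}) (c ` {..<?s}) = P" using \<pi>(2) by simp
    then show False using cls M(1) P(2) unfolding matrix_class_def by metis
  qed
  have "card {S. S \<subseteq> {..<m} \<and> S \<noteq> {} \<and> k \<le> card (common (ones M) {..<dim_col M} S)}
    \<le> (card {..<m} + card {..<dim_col M}) * 2 ^ (mt_const q + k)"
    using free
  proof (intro card_row_sets)
    fix R' K' assume RK: "R' \<subseteq> {..<m}" "K' \<subseteq> {..<dim_col M}" "R' \<noteq> {} \<or> K' \<noteq> {}"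
    then have "finite R'" "finite K'" by (auto intro: finite_subset)
    then show "(\<exists>i\<in>R'. card {j \<in> K'. (i, j) \<in> ones M} \<le> mt_const q) \<or>
      (\<exists>j\<in>K'. card {i \<in> R'. (i, j) \<in> ones M} \<le> mt_const q)"
      using low_degree_vertex[OF \<sigma> no_pattern[OF RK(1,2)]] RK(3) by blast
  qed auto
  then show ?thesis by (simp add: sets_bound_def q_def N_def)
qed

section \<open>Computable bounds\<close>

text \<open>Total correctness, with the running time handed to the postcondition. Runs are
  deterministic, so existence of a run says everything about it.\<close>

definition wp :: "com \<Rightarrow> state \<Rightarrow> (nat \<Rightarrow> state \<Rightarrow> bool) \<Rightarrow> bool" where
  "wp c s Q \<longleftrightarrow> (\<exists>t s'. exec c s t s' \<and> Q t s')"

lemma wp_Skip [simp]: "wp Skip s Q \<longleftrightarrow> Q 1 s"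
  unfolding wp_def by (metis exec.Skip exec_elims(1))

lemma wp_Assign [simp]: "wp (Assign x e) s Q \<longleftrightarrow> Q (1 + cost e) (s(x := val e s))"
  unfolding wp_def by (metis exec.Assign exec_elims(2))

lemma wp_Seq [simp]: "wp (Seq c d) s Q \<longleftrightarrow> wp c s (\<lambda>t s'. wp d s' (\<lambda>u s''. Q (t + u) s''))"
  unfolding wp_def by (blast intro: exec.Seq elim: exec_elims(3))

lemma exec_Cond_iff: "exec (Cond e c d) s t s' \<longleftrightarrow>
    (\<exists>u. t = 1 + cost e + u \<and> exec (if val e s \<noteq> Leaf then c else d) s u s')"
    (is "?L \<longleftrightarrow> ?R")
proof
  assume ?L
  then show ?R by (rule exec_elims(4)) auto
next
  assume ?R
  then obtain u where u: "t = 1 + cost e + u" "exec (if val e s \<noteq> Leaf then c else d) s u s'"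
    by blast
  show ?L
  proof (cases "val e s = Leaf")
    case True
    then show ?thesis unfolding u(1) using u(2) by (intro exec.CondFalse) auto
  next
    case False
    then show ?thesis unfolding u(1) using u(2) by (intro exec.CondTrue) auto
  qed
qed

lemma wp_Cond [simp]:
  "wp (Cond e c d) s Q \<longleftrightarrow>
     wp (if val e s \<noteq> Leaf then c else d) s (\<lambda>t. Q (1 + cost e + t))"
  unfolding wp_def exec_Cond_iff by blast

lemma wp_WhileFalse: "val e s = Leaf \<Longrightarrow> Q (1 + cost e) s \<Longrightarrow> wp (While e c) s Q"
  unfolding wp_def by (blast intro: exec.WhileFalse)

lemma wp_WhileTrue:
  assumes "val e s \<noteq> Leaf"
    and "wp c s (\<lambda>t s'. wp (While e c) s' (\<lambda>u s''. Q (1 + cost e + t + u) s''))"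
  shows "wp (While e c) s Q"
  using assms unfolding wp_def by (blast intro: exec.WhileTrue)

lemma wp_mono: "wp c s Q \<Longrightarrow> (\<And>t s'. Q t s' \<Longrightarrow> R t s') \<Longrightarrow> wp c s R"
  unfolding wp_def by blast

section \<open>Variable frames and composable programs\<close>

fun exp_below :: "nat \<Rightarrow> exp \<Rightarrow> bool" where
  "exp_below m (EVar x) \<longleftrightarrow> x < m"
| "exp_below m ELeaf \<longleftrightarrow> True"
| "exp_below m (ECons e f) \<longleftrightarrow> exp_below m e \<and> exp_below m f"
| "exp_below m (EHd e) \<longleftrightarrow> exp_below m e"
| "exp_below m (ETl e) \<longleftrightarrow> exp_below m e"

fun com_below :: "nat \<Rightarrow> com \<Rightarrow> bool" where
  "com_below m Skip \<longleftrightarrow> True"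
| "com_below m (Assign x e) \<longleftrightarrow> x < m \<and> exp_below m e"
| "com_below m (Seq c d) \<longleftrightarrow> com_below m c \<and> com_below m d"
| "com_below m (Cond e c d) \<longleftrightarrow> exp_below m e \<and> com_below m c \<and> com_below m d"
| "com_below m (While e c) \<longleftrightarrow> exp_below m e \<and> com_below m c"

lemma exp_below_mono: "exp_below m e \<Longrightarrow> m \<le> n \<Longrightarrow> exp_below n e"
  by (induction e) auto

lemma com_below_mono: "com_below m c \<Longrightarrow> m \<le> n \<Longrightarrow> com_below n c"
  by (induction c) (auto intro: exp_below_mono)

lemma ex_exp_below: "\<exists>m. exp_below m e"
proof (induction e)
  case (ECons e f)
  then show ?case by (meson exp_below.simps(3) exp_below_mono max.cobounded1 max.cobounded2)
qed (auto intro: exI[of _ "Suc _"])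

lemma ex_com_below: "\<exists>m. com_below m c"
proof (induction c)
  case (Assign x e)
  obtain m where "exp_below m e" using ex_exp_below by blast
  then have "com_below (max m (Suc x)) (Assign x e)" by (auto intro: exp_below_mono)
  then show ?case by blast
next
  case (Seq c d)
  then show ?case by (meson com_below.simps(3) com_below_mono max.cobounded1 max.cobounded2)
next
  case (Cond e c d)
  obtain m where "exp_below m e" using ex_exp_below by blast
  moreover obtain n1 n2 where "com_below n1 c" "com_below n2 d" using Cond by blast
  ultimately have "com_below (max m (max n1 n2)) (Cond e c d)"
    by (auto intro: exp_below_mono com_below_mono)
  then show ?case by blast
next
  case (While e c)
  obtain m where "exp_below m e" using ex_exp_below by blast
  moreover obtain n where "com_below n c" using While by blast
  ultimately have "com_below (max m n) (While e c)"
    by (auto intro: exp_below_mono com_below_mono)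
  then show ?case by blast
qed auto

lemma val_cong: "exp_below m e \<Longrightarrow> (\<And>x. x < m \<Longrightarrow> r x = s x) \<Longrightarrow> val e r = val e s"
  by (induction e) auto

lemma exec_frame: "exec c s t s' \<Longrightarrow> com_below m c \<Longrightarrow> m \<le> x \<Longrightarrow> s' x = s x"
  by (induction rule: exec.induct) auto

text \<open>\<open>computable\<close> speaks only of a start in which all variables but 0 are
  \<open>Leaf\<close>; this transfers a run to starting states with other contents in the variables
  that the program does not mention.\<close>

lemma exec_cong:
  "exec c s t s' \<Longrightarrow> com_below m c \<Longrightarrow> (\<And>x. x < m \<Longrightarrow> r x = s x) \<Longrightarrow>
    \<exists>r'. exec c r t r' \<and> (\<forall>x<m. r' x = s' x)"
proof (induction arbitrary: r rule: exec.induct)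
  case (Skip s)
  then show ?case by (blast intro: exec.Skip)
next
  case (Assign x e s)
  have "val e r = val e s" using Assign by (intro val_cong) auto
  then show ?case using Assign by (intro exI[of _ "r(x := val e r)"] conjI exec.Assign) auto
next
  case (Seq c s t s1 d u s2)
  obtain r1 where r1: "exec c r t r1" "\<forall>x<m. r1 x = s1 x"
    using Seq.IH(1)[of r] Seq.prems by auto
  then obtain r2 where "exec d r1 u r2" "\<forall>x<m. r2 x = s2 x"
    using Seq.IH(2)[of r1] Seq.prems by auto
  then show ?case using r1 by (blast intro: exec.Seq)
next
  case (CondTrue e s c t s1 d)
  have "val e r = val e s" using CondTrue.prems by (intro val_cong) auto
  moreover obtain r1 where "exec c r t r1" "\<forall>x<m. r1 x = s1 x"
    using CondTrue.IH[of r] CondTrue.prems by auto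
  ultimately show ?case using CondTrue.hyps by (metis exec.CondTrue)
next
  case (CondFalse e s d t s1 c)
  have "val e r = val e s" using CondFalse.prems by (intro val_cong) auto
  moreover obtain r1 where "exec d r t r1" "\<forall>x<m. r1 x = s1 x"
    using CondFalse.IH[of r] CondFalse.prems by auto
  ultimately show ?case using CondFalse.hyps by (metis exec.CondFalse)
next
  case (WhileFalse e s c)
  have "val e r = val e s" using WhileFalse.prems by (intro val_cong) auto
  then show ?case using WhileFalse by (metis exec.WhileFalse)
next
  case (WhileTrue e s c t s1 u s2)
  have v: "val e r = val e s" using WhileTrue.prems by (intro val_cong) auto
  obtain r1 where r1: "exec c r t r1" "\<forall>x<m. r1 x = s1 x"
    using WhileTrue.IH(1)[of r] WhileTrue.prems by auto
  then obtain r2 where "exec (While e c) r1 u r2" "\<forall>x<m. r2 x = s2 x"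
    using WhileTrue.IH(2)[of r1] WhileTrue.prems by auto
  then show ?case using r1 v WhileTrue.hyps(1) by (metis exec.WhileTrue)
qed

text \<open>A form of computing a function that can serve as a subroutine: any garbage may be
  present at the start, and the variables from \<open>m\<close> on are preserved and can hold data
  of the caller. \<open>0 < m\<close> keeps the output variable out of the preserved range.\<close>

definition robustly_computes :: "nat \<Rightarrow> com \<Rightarrow> (nat \<Rightarrow> nat) \<Rightarrow> bool" where
  "robustly_computes m p f \<longleftrightarrow> 0 < m \<and>
    (\<forall>n s. s 0 = enc_nat n \<longrightarrow>
      wp p s (\<lambda>t s'. s' 0 = enc_nat (f n) \<and> (\<forall>x\<ge>m. s' x = s x)))"

fun clear :: "nat \<Rightarrow> com" where
  "clear 0 = Skip"
| "clear (Suc m) = Seq (clear m) (if m = 0 then Skip else Assign m ELeaf)"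

lemma wp_clear: "wp (clear m) s (\<lambda>t s'. s' = (\<lambda>x. if 0 < x \<and> x < m then Leaf else s x))"
proof (induction m)
  case (Suc m)
  then show ?case by (auto elim!: wp_mono)
qed simp

lemma computable_iff_robust: "computable f \<longleftrightarrow> (\<exists>m p. robustly_computes m p f)"
proof
  assume "computable f"
  then obtain p where p: "\<And>n. \<exists>t. runs p (enc_nat n) t (enc_nat (f n))"
    unfolding computable_def by blast
  obtain m0 where "com_below m0 p" using ex_com_below by blast
  define m where "m = Suc m0"
  have m: "com_below m p" using \<open>com_below m0 p\<close> by (rule com_below_mono) (simp add: m_def)
  \<comment> \<open>Clearing the variables \<open>1\<close> to \<open>m - 1\<close> recreates the
    start assumed by \<open>runs\<close>, as far as \<open>p\<close> can see.\<close>
  have "robustly_computes m (Seq (clear m) p) f"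
    unfolding robustly_computes_def
  proof (intro conjI allI impI)
    show "0 < m" by (simp add: m_def)
    fix n and s :: state assume s0: "s 0 = enc_nat n"
    obtain t s' where s': "exec p ((\<lambda>_. Leaf)(0 := enc_nat n)) t s'" "s' 0 = enc_nat (f n)"
      using p[of n] unfolding runs_def by blast
    let ?r = "\<lambda>x. if 0 < x \<and> x < m then Leaf else s x"
    have "\<exists>r'. exec p ?r t r' \<and> (\<forall>x<m. r' x = s' x)"
      by (rule exec_cong[OF s'(1) m]) (use s0 in auto)
    then obtain r' where r': "exec p ?r t r'" "\<forall>x<m. r' x = s' x" by blast
    have "wp p ?r (\<lambda>t s''. s'' 0 = enc_nat (f n) \<and> (\<forall>x\<ge>m. s'' x = s x))"
      unfolding wp_def using r' s'(2) exec_frame[OF r'(1) m]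
      by (intro exI[of _ t] exI[of _ r']) (auto simp: m_def)
    then show "wp (Seq (clear m) p) s (\<lambda>t s'. s' 0 = enc_nat (f n) \<and> (\<forall>x\<ge>m. s' x = s x))"
      unfolding wp_Seq by (intro wp_mono[OF wp_clear]) simp
  qed
  then show "\<exists>m p. robustly_computes m p f" by blast
next
  assume "\<exists>m p. robustly_computes m p f"
  then obtain m p where "robustly_computes m p f" by blast
  then have "wp p ((\<lambda>_. Leaf)(0 := enc_nat n))
      (\<lambda>t s'. s' 0 = enc_nat (f n) \<and> (\<forall>x\<ge>m. s' x = ((\<lambda>_. Leaf)(0 := enc_nat n)) x))" for n
    unfolding robustly_computes_def by (meson fun_upd_same)
  then show "computable f" unfolding computable_def runs_def wp_def by blast
qed

lemma enc_nat_simps [simp]: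
  "enc_nat 0 = Leaf" "enc_nat (Suc n) = Node Leaf (enc_nat n)"
  by (simp_all add: enc_nat_def)

lemma enc_nat_eq_Leaf_iff [simp]: "enc_nat n = Leaf \<longleftrightarrow> n = 0"
  by (cases n) auto

lemma right_enc_nat [simp]: "right (enc_nat n) = enc_nat (n - 1)"
  by (cases n) auto

section \<open>Closure of computable functions under composition and iteration\<close>

lemma computable_Suc: "computable Suc"
proof -
  have "robustly_computes 1 (Assign 0 (ECons ELeaf (EVar 0))) Suc"
    by (simp add: robustly_computes_def)
  then show ?thesis using computable_iff_robust by blast
qed

lemma computable_comp:
  assumes "computable f" "computable g"
  shows "computable (\<lambda>n. f (g n))"
proof -
  obtain m p where p: "robustly_computes m p f" using assms(1) computable_iff_robust by blast
  obtain m' p' where p': "robustly_computes m' p' g" using assms(2) computable_iff_robust by blast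
  have "robustly_computes (max m m') (Seq p' p) (\<lambda>n. f (g n))"
    unfolding robustly_computes_def
  proof (intro conjI allI impI)
    show "0 < max m m'" using p by (simp add: robustly_computes_def less_max_iff_disj)
    fix n and s :: state assume "s 0 = enc_nat n"
    then have "wp p' s (\<lambda>t s'. s' 0 = enc_nat (g n) \<and> (\<forall>x\<ge>m'. s' x = s x))"
      using p' by (simp add: robustly_computes_def)
    then show "wp (Seq p' p) s (\<lambda>t s'. s' 0 = enc_nat (f (g n)) \<and> (\<forall>x\<ge>max m m'. s' x = s x))"
      unfolding wp_Seq
    proof (rule wp_mono)
      fix t s' assume s': "s' 0 = enc_nat (g n) \<and> (\<forall>x\<ge>m'. s' x = s x)"
      then have "wp p s' (\<lambda>t s''. s'' 0 = enc_nat (f (g n)) \<and> (\<forall>x\<ge>m. s'' x = s' x))"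
        using p by (simp add: robustly_computes_def)
      then show "wp p s' (\<lambda>t s''. s'' 0 = enc_nat (f (g n)) \<and> (\<forall>x\<ge>max m m'. s'' x = s x))"
        by (rule wp_mono) (use s' in auto)
    qed
  qed
  then show ?thesis using computable_iff_robust by blast
qed

text \<open>The variable \<open>m\<close> is preserved by \<open>p\<close> and counts down from the
  input. Using the input as both count and starting value stays within unary functions, and leads
  from \<open>Suc\<close> to doubling and from doubling to powers of 2.\<close>

lemma computable_iterate:
  assumes "computable f"
  shows "computable (\<lambda>n. (f ^^ n) n)"
proof -
  obtain m p where p: "robustly_computes m p f" using assms(1) computable_iff_robust by blast
  then have m: "0 < m" by (simp add: robustly_computes_def)
  let ?w = "While (EVar m) (Seq p (Assign m (ETl (EVar m))))"
  have loop: "wp ?w s (\<lambda>t s'. s' 0 = enc_nat ((f ^^ i) n) \<and> (\<forall>x\<ge>Suc m. s' x = s x))"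
    if "s 0 = enc_nat n" "s m = enc_nat i" for s i n
    using that
  proof (induction i arbitrary: s n)
    case 0
    then show ?case by (intro wp_WhileFalse) auto
  next
    case (Suc i)
    have "wp p s (\<lambda>t s'. s' 0 = enc_nat (f n) \<and> (\<forall>x\<ge>m. s' x = s x))"
      using p Suc.prems(1) by (simp add: robustly_computes_def)
    then show ?case
    proof (intro wp_WhileTrue, goal_cases)
      case 1
      show ?case using Suc.prems by simp
    next
      case 2
      show ?case
        unfolding wp_Seq wp_Assign
      proof (rule wp_mono[OF 2])
        fix t s' assume s': "s' 0 = enc_nat (f n) \<and> (\<forall>x\<ge>m. s' x = s x)"
        have "wp ?w (s'(m := val (ETl (EVar m)) s'))
          (\<lambda>t r. r 0 = enc_nat ((f ^^ i) (f n)) \<and>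
             (\<forall>x\<ge>Suc m. r x = (s'(m := val (ETl (EVar m)) s')) x))"
          using s' m Suc.prems by (intro Suc.IH) auto
        then show "wp ?w (s'(m := val (ETl (EVar m)) s'))
          (\<lambda>u r. r 0 = enc_nat ((f ^^ Suc i) n) \<and> (\<forall>x\<ge>Suc m. r x = s x))"
          by (rule wp_mono) (use s' in \<open>auto simp: funpow_swap1\<close>)
      qed
    qed
  qed
  have "robustly_computes (Suc m) (Seq (Assign m (EVar 0)) ?w) (\<lambda>n. (f ^^ n) n)"
    unfolding robustly_computes_def wp_Seq wp_Assign
  proof (intro conjI allI impI)
    fix n and s :: state assume "s 0 = enc_nat n"
    then have "wp ?w (s(m := val (EVar 0) s)) (\<lambda>t s'. s' 0 = enc_nat ((f ^^ n) n) \<and>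
      (\<forall>x\<ge>Suc m. s' x = (s(m := val (EVar 0) s)) x))"
      using m by (intro loop) auto
    then show "wp ?w (s(m := val (EVar 0) s)) (\<lambda>t s'. s' 0 = enc_nat ((f ^^ n) n) \<and>
      (\<forall>x\<ge>Suc m. s' x = s x))"
      by (rule wp_mono) auto
  qed simp
  then show ?thesis using computable_iff_robust by blast
qed

text \<open>Requiring \<open>h\<close> to be monotone and \<open>n \<le> h n\<close> makes composition dominate the maximum, so that
  closure under composition and iteration gives all elementary functions without any computable
  function of several arguments.\<close>

definition computably_bounded :: "(nat \<Rightarrow> nat) \<Rightarrow> bool" where
  "computably_bounded g \<longleftrightarrow> (\<exists>h. computable h \<and> mono h \<and> (\<forall>n. n \<le> h n) \<and> (\<forall>n. g n \<le> h n))"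

lemma computably_boundedI:
  "computable h \<Longrightarrow> mono h \<Longrightarrow> (\<And>n. n \<le> h n) \<Longrightarrow> (\<And>n. g n \<le> h n) \<Longrightarrow> computably_bounded g"
  unfolding computably_bounded_def by blast

lemma computably_boundedE:
  assumes "computably_bounded g"
  obtains h where "computable h" "mono h" "\<And>n. n \<le> h n" "\<And>n. g n \<le> h n"
  using assms unfolding computably_bounded_def by blast

lemma computably_bounded_le:
  assumes "computably_bounded g" "\<And>n. f n \<le> g n"
  shows "computably_bounded f"
  using assms(1) by (rule computably_boundedE) (meson assms(2) computably_boundedI order_trans)

lemma computably_bounded_comp:
  assumes "computably_bounded f" "computably_bounded g"
  shows "computably_bounded (\<lambda>n. f (g n))"
proof -
  obtain h where h: "computable h" "mono h" "\<And>n. n \<le> h n" "\<And>n. f n \<le> h n"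
    using assms(1) by (rule computably_boundedE) blast
  obtain k where k: "computable k" "mono k" "\<And>n. n \<le> k n" "\<And>n. g n \<le> k n"
    using assms(2) by (rule computably_boundedE) blast
  show ?thesis
  proof (rule computably_boundedI[OF computable_comp[OF h(1) k(1)]])
    show "mono (\<lambda>n. h (k n))" using h(2) k(2) by (simp add: mono_def)
    show "n \<le> h (k n)" for n using h(3) k(3) by (meson order_trans)
    show "f (g n) \<le> h (k n)" for n using h(4)[of "g n"] monoD[OF h(2) k(4)] by (rule order_trans)
  qed
qed

lemma computably_bounded_max:
  assumes "computably_bounded f" "computably_bounded g"
  shows "computably_bounded (\<lambda>n. max (f n) (g n))"
proof -
  obtain h where h: "computable h" "mono h" "\<And>n. n \<le> h n" "\<And>n. f n \<le> h n"
    using assms(1) by (rule computably_boundedE) blast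
  obtain k where k: "computable k" "mono k" "\<And>n. n \<le> k n" "\<And>n. g n \<le> k n"
    using assms(2) by (rule computably_boundedE) blast
  show ?thesis
  proof (rule computably_boundedI[OF computable_comp[OF h(1) k(1)]])
    show "mono (\<lambda>n. h (k n))" using h(2) k(2) by (simp add: mono_def)
    show "n \<le> h (k n)" for n using h(3) k(3) by (meson order_trans)
    have "f n \<le> h (k n)" for n using h(4)[of n] monoD[OF h(2) k(3)] by (rule order_trans)
    moreover have "g n \<le> h (k n)" for n using k(4)[of n] h(3)[of "k n"] by (rule order_trans)
    ultimately show "max (f n) (g n) \<le> h (k n)" for n by simp
  qed
qed

lemma computably_bounded_iterate:
  assumes "computable f" "mono f" "\<And>n. n \<le> f n"
  shows "computably_bounded (\<lambda>n. (f ^^ n) n)"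
proof -
  have grow: "x \<le> (f ^^ i) x" for x i
    by (induction i) (auto intro: order_trans assms(3))
  have step: "(f ^^ i) x \<le> (f ^^ (i + d)) x" for i d x
    by (induction d) (auto intro: order_trans assms(3))
  have mon: "mono (f ^^ i)" for i
    using assms(2) by (rule mono_pow)
  show ?thesis
  proof (rule computably_boundedI[OF computable_iterate[OF assms(1)]])
    show "mono (\<lambda>n. (f ^^ n) n)"
    proof (rule monoI)
      fix a b :: nat assume "a \<le> b"
      have "(f ^^ a) a \<le> (f ^^ a) b" using mon \<open>a \<le> b\<close> by (rule monoD)
      also have "\<dots> \<le> (f ^^ b) b" using step[of a b "b - a"] \<open>a \<le> b\<close> by simp
      finally show "(f ^^ a) a \<le> (f ^^ b) b" .
    qed
  qed (use grow in auto)
qed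

lemma computably_bounded_Suc: "computably_bounded Suc"
  by (rule computably_boundedI[OF computable_Suc]) (auto simp: mono_def)

lemma computably_bounded_id: "computably_bounded (\<lambda>n. n)"
  by (rule computably_bounded_le[OF computably_bounded_Suc]) simp

lemma computable_double: "computable (\<lambda>n. 2 * n)"
proof -
  have "(Suc ^^ n) m = n + m" for n m by (induction n) auto
  then show ?thesis using computable_iterate[OF computable_Suc] by (simp add: mult_2)
qed

lemma computably_bounded_double: "computably_bounded (\<lambda>n. 2 * n)"
  by (rule computably_boundedI[OF computable_double]) (auto simp: mono_def)

lemma computably_bounded_power2: "computably_bounded (\<lambda>n. 2 ^ n)"
proof -
  have "computably_bounded (\<lambda>n. ((\<lambda>n. 2 * n) ^^ n) n)"
    by (rule computably_bounded_iterate[OF computable_double]) (auto simp: mono_def)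
  moreover have "((\<lambda>n. 2 * n) ^^ i) n = 2 ^ i * n" for i n :: nat by (induction i) auto
  ultimately have "computably_bounded (\<lambda>n. 2 ^ n * n)" by simp
  \<comment> \<open>At \<open>n = 0\<close> the product \<open>2 ^ n * n\<close> vanishes, so it
    dominates \<open>2 ^ n\<close> only after a shift by one.\<close>
  from computably_bounded_comp[OF this computably_bounded_Suc]
  show ?thesis by (rule computably_bounded_le) (simp add: algebra_simps)
qed

lemma computably_bounded_const: "computably_bounded (\<lambda>n. c)"
proof (induction c)
  case 0
  show ?case by (rule computably_bounded_le[OF computably_bounded_id]) simp
next
  case (Suc c)
  show ?case by (rule computably_bounded_comp[OF computably_bounded_Suc Suc])
qed

lemma computably_bounded_add:
  assumes "computably_bounded f" "computably_bounded g"
  shows "computably_bounded (\<lambda>n. f n + g n)"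
  by (rule computably_bounded_le[OF computably_bounded_comp[OF computably_bounded_double
        computably_bounded_max[OF assms]]]) simp

lemma computably_bounded_mult:
  assumes "computably_bounded f" "computably_bounded g"
  shows "computably_bounded (\<lambda>n. f n * g n)"
proof (rule computably_bounded_le[OF computably_bounded_comp[OF computably_bounded_power2
        computably_bounded_add[OF assms]]])
  show "f n * g n \<le> 2 ^ (f n + g n)" for n
    unfolding power_add by (intro mult_mono) (auto intro: less_imp_le)
qed

lemmas computably_bounded_intros =
  computably_bounded_id computably_bounded_const computably_bounded_add computably_bounded_mult
  computably_bounded_comp[OF computably_bounded_power2]

lemma computably_bounded_mt_const: "computably_bounded mt_const"
proof -
  have "computably_bounded (\<lambda>q. 2 * q * 2 ^ (4 * q * q) * (4 * q * q) * (4 * q * q))"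
    by (intro computably_bounded_intros)
  then show ?thesis unfolding mt_const_def .
qed

lemma computably_bounded_blow_up: "computably_bounded (blow_up s)"
proof -
  have "computably_bounded (\<lambda>k. 8 * k * 2 ^ (8 * k) * 2 ^ s)"
    by (intro computably_bounded_intros)
  then show ?thesis unfolding blow_up_def sparse_size_def .
qed

lemma computably_bounded_sets_bound: "computably_bounded (\<lambda>k. c * sets_bound s k)"
  unfolding sets_bound_def
  by (intro computably_bounded_intros computably_bounded_blow_up
      computably_bounded_comp[OF computably_bounded_mt_const])

section \<open>The algorithm\<close>

abbreviation enc_bools :: "bool list \<Rightarrow> tree" where
  "enc_bools bs \<equiv> enc_list (map enc_bool bs)"

lemma enc_list_eq_Leaf_iff [simp]: "enc_list xs = Leaf \<longleftrightarrow> xs = []"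
  by (cases xs) auto

lemma left_enc_list [simp]: "left (enc_list xs) = (if xs = [] then Leaf else hd xs)"
  by (cases xs) auto

lemma right_enc_list [simp]: "right (enc_list xs) = enc_list (tl xs)"
  by (cases xs) auto

lemma enc_bool_eq_Leaf_iff [simp]: "enc_bool b = Leaf \<longleftrightarrow> \<not> b"
  by (simp add: enc_bool_def)

text \<open>Variables of the program: 0 output, 1 unread rows, 2 \<open>k\<close>, 3 stored entries, 4 current row,
  5 entries still to be extended, 6 and 7 the two components of the current entry, 8 unread part of
  the current row, 9 \<open>k\<close> minus the number of good columns found, 10 new bad columns in reverse order.\<close>

abbreviation ETrue :: exp where
  "ETrue \<equiv> ECons ELeaf ELeaf"

text \<open>The first argument marks the columns that are bad for a set of rows (the empty list stands for
  no bad columns, whatever the length); the second argument is a new row.\<close>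

fun merge :: "bool list \<Rightarrow> bool list \<Rightarrow> bool list" where
  "merge vs [] = []"
| "merge vs (b # bs) = ((vs \<noteq> [] \<and> hd vs) \<or> \<not> b) # merge (tl vs) bs"

section \<open>Programs for one entry and one row\<close>

text \<open>Head and tail of \<open>Leaf\<close> are \<open>Leaf\<close>. Hence the empty list of
  bad columns reads as "not bad" forever, and the countdown in variable 9 stops at 0. It is empty at
  the end exactly if at least \<open>k\<close> good columns were found, so numbers are compared by a
  leaf test alone.\<close>

definition scan_step :: com where
  "scan_step =
    Seq (Cond (EHd (EVar 7)) (Assign 10 (ECons ETrue (EVar 10)))
      (Cond (EHd (EVar 8))
        (Seq (Assign 10 (ECons ELeaf (EVar 10))) (Assign 9 (ETl (EVar 9))))
        (Assign 10 (ECons ETrue (EVar 10)))))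
    (Seq (Assign 7 (ETl (EVar 7))) (Assign 8 (ETl (EVar 8))))"

lemma wp_scan_step:
  fixes s :: state
  assumes "s 8 = enc_bools (b # bs)" "s 7 = enc_bools vs" "s 9 = enc_nat n" "s 10 = enc_bools as"
    and x: "x \<longleftrightarrow> (vs \<noteq> [] \<and> hd vs) \<or> \<not> b"
  shows "wp scan_step s (\<lambda>t s'. t \<le> 28 \<and> s' 8 = enc_bools bs \<and> s' 7 = enc_bools (tl vs) \<and>
    s' 9 = enc_nat (if x then n else n - 1) \<and> s' 10 = enc_bools (x # as) \<and>
    (\<forall>y. y \<notin> {7, 8, 9, 10} \<longrightarrow> s' y = s y))"
proof (cases "vs \<noteq> [] \<and> hd vs")
  case True
  then have "left (s 7) \<noteq> Leaf" using assms(2) by (simp add: hd_map)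
  then show ?thesis using assms True by (simp add: scan_step_def map_tl enc_bool_def)
next
  case False
  then have l: "left (s 7) = Leaf" using assms(2) by (auto simp: hd_map)
  show ?thesis
    using assms False l by (cases b) (simp_all add: scan_step_def map_tl enc_bool_def)
qed

lemma wp_scan:
  fixes s :: state
  assumes "s 8 = enc_bools bs" "s 7 = enc_bools vs" "s 9 = enc_nat n" "s 10 = enc_bools as"
  shows "wp (While (EVar 8) scan_step) s (\<lambda>t s'. t \<le> 30 * length bs + 2 \<and>
    s' 9 = enc_nat (n - count_list (merge vs bs) False) \<and>
    s' 10 = enc_bools (rev (merge vs bs) @ as) \<and> (\<forall>y. y \<notin> {7, 8, 9, 10} \<longrightarrow> s' y = s y))"
  using assms
proof (induction bs arbitrary: s vs n as)
  case Nil
  then show ?case by (intro wp_WhileFalse) auto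
next
  case (Cons b bs)
  define x where "x \<longleftrightarrow> (vs \<noteq> [] \<and> hd vs) \<or> \<not> b"
  show ?case
  proof (rule wp_WhileTrue)
    show "val (EVar 8) s \<noteq> Leaf" using Cons.prems by simp
    show "wp scan_step s (\<lambda>t s'. wp (While (EVar 8) scan_step) s' (\<lambda>u s''.
      1 + cost (EVar 8) + t + u \<le> 30 * length (b # bs) + 2 \<and>
      s'' 9 = enc_nat (n - count_list (merge vs (b # bs)) False) \<and>
      s'' 10 = enc_bools (rev (merge vs (b # bs)) @ as) \<and>
      (\<forall>y. y \<notin> {7, 8, 9, 10} \<longrightarrow> s'' y = s y)))"
    proof (rule wp_mono[OF wp_scan_step[OF Cons.prems x_def]], elim conjE)
      fix t :: nat and s' :: state
      assume t: "t \<le> 28" and s': "s' 8 = enc_bools bs" "s' 7 = enc_bools (tl vs)"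
        "s' 9 = enc_nat (if x then n else n - 1)" "s' 10 = enc_bools (x # as)"
        and frame: "\<forall>y. y \<notin> {7, 8, 9, 10} \<longrightarrow> s' y = s y"
      have m: "merge vs (b # bs) = x # merge (tl vs) bs" by (simp add: x_def)
      show "wp (While (EVar 8) scan_step) s' (\<lambda>u s''.
        1 + cost (EVar 8) + t + u \<le> 30 * length (b # bs) + 2 \<and>
        s'' 9 = enc_nat (n - count_list (merge vs (b # bs)) False) \<and>
        s'' 10 = enc_bools (rev (merge vs (b # bs)) @ as) \<and>
        (\<forall>y. y \<notin> {7, 8, 9, 10} \<longrightarrow> s'' y = s y))"
        unfolding m by (rule wp_mono[OF Cons.IH[OF s']]) (use t frame in auto)
    qed
  qed
qed

definition reverse_step :: com where
  "reverse_step = Seq (Assign 7 (ECons (EHd (EVar 10)) (EVar 7))) (Assign 10 (ETl (EVar 10)))"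

lemma wp_reverse:
  fixes s :: state
  assumes "s 10 = enc_list xs" "s 7 = enc_list ys"
  shows "wp (While (EVar 10) reverse_step) s (\<lambda>t s'. t \<le> 10 * length xs + 2 \<and>
    s' 7 = enc_list (rev xs @ ys) \<and> (\<forall>y. y \<notin> {7, 10} \<longrightarrow> s' y = s y))"
  using assms
proof (induction xs arbitrary: s ys)
  case Nil
  then show ?case by (intro wp_WhileFalse) auto
next
  case (Cons x xs)
  let ?s = "s(7 := Node x (enc_list ys), 10 := enc_list xs)"
  have "wp (While (EVar 10) reverse_step) ?s (\<lambda>t s'. t \<le> 10 * length xs + 2 \<and>
    s' 7 = enc_list (rev xs @ (x # ys)) \<and> (\<forall>y. y \<notin> {7, 10} \<longrightarrow> s' y = ?s y))"
    by (rule Cons.IH) auto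
  then show ?case
    using Cons.prems
    by (intro wp_WhileTrue) (auto simp: reverse_step_def elim!: wp_mono)
qed

definition enc_entry :: "nat \<times> bool list \<Rightarrow> tree" where
  "enc_entry e = Node (enc_nat (fst e)) (enc_bools (snd e))"

definition extend_entry :: "nat \<Rightarrow> bool list \<Rightarrow> nat \<times> bool list \<Rightarrow> (nat \<times> bool list) list" where
  "extend_entry k bs e = (let w = merge (snd e) bs in
     if k \<le> count_list w False then [(fst e - 1, w)] else [])"

text \<open>When no row is missing any more, the answer is set and variable 1 is emptied, which ends
  the outer loop. The loop over the remaining entries of the current row still runs to its
  end.\<close>

definition store_entry :: com where
  "store_entry =
    Cond (EVar 9) Skip
      (Seq (Assign 7 ELeaf)
      (Seq (While (EVar 10) reverse_step)
      (Seq (Assign 6 (ETl (EVar 6)))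
      (Seq (Assign 3 (ECons (ECons (EVar 6) (EVar 7)) (EVar 3)))
      (Cond (EVar 6) Skip (Seq (Assign 0 ETrue) (Assign 1 ELeaf)))))))"

definition entry_body :: com where
  "entry_body =
    Seq (Assign 6 (EHd (EHd (EVar 5))))
    (Seq (Assign 7 (ETl (EHd (EVar 5))))
    (Seq (Assign 5 (ETl (EVar 5)))
    (Seq (Assign 8 (EVar 4))
    (Seq (Assign 9 (EVar 2))
    (Seq (Assign 10 ELeaf)
    (Seq (While (EVar 8) scan_step) store_entry))))))"

lemma length_merge [simp]: "length (merge vs bs) = length bs"
  by (induction vs bs rule: merge.induct) auto

lemma wp_entry_body:
  fixes s :: state
  assumes "s 5 = Node (enc_entry e) T" "s 4 = enc_bools bs" "s 2 = enc_nat k"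
    "s 3 = enc_list (map enc_entry fam)"
  shows "wp entry_body s (\<lambda>t s'. t \<le> 40 * length bs + 60 \<and> s' 5 = T \<and>
    s' 3 = enc_list (map enc_entry (rev (extend_entry k bs e) @ fam)) \<and>
    (if 0 \<in> fst ` set (extend_entry k bs e) then s' 0 = enc_bool True \<and> s' 1 = Leaf
     else s' 0 = s 0 \<and> s' 1 = s 1) \<and> s' 4 = s 4 \<and> s' 2 = s 2)"
proof -
  let ?w = "merge (snd e) bs"
  define s1 where "s1 = s(6 := enc_nat (fst e), 7 := enc_bools (snd e), 5 := T,
    8 := enc_bools bs, 9 := enc_nat k, 10 := Leaf)"
  have scan: "wp (While (EVar 8) scan_step) s1 (\<lambda>t s'. t \<le> 30 * length bs + 2 \<and>
    s' 9 = enc_nat (k - count_list ?w False) \<and>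
    s' 10 = enc_bools (rev ?w @ []) \<and> (\<forall>y. y \<notin> {7, 8, 9, 10} \<longrightarrow> s' y = s1 y))"
    by (rule wp_scan) (simp_all add: s1_def)
  define Q where "Q t s' \<longleftrightarrow> t \<le> 40 * length bs + 60 \<and> s' 5 = T \<and>
    s' 3 = enc_list (map enc_entry (rev (extend_entry k bs e) @ fam)) \<and>
    (if 0 \<in> fst ` set (extend_entry k bs e) then s' 0 = enc_bool True \<and> s' 1 = Leaf
     else s' 0 = s 0 \<and> s' 1 = s 1) \<and> s' 4 = s 4 \<and> s' 2 = s 2" for t and s' :: state
  \<comment> \<open>The six assignments before the scan cost 17.\<close>
  have "wp store_entry s2 (\<lambda>u. Q (17 + (t + u)))"
    if t: "t \<le> 30 * length bs + 2" and s2: "s2 9 = enc_nat (k - count_list ?w False)"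
      "s2 10 = enc_bools (rev ?w)" "\<forall>y. y \<notin> {7, 8, 9, 10} \<longrightarrow> s2 y = s1 y" for t s2
  proof (cases "k \<le> count_list ?w False")
    case False
    then show ?thesis using t s2 assms by (simp add: store_entry_def Q_def extend_entry_def s1_def)
  next
    case True
    let ?s3 = "s2(7 := Leaf)"
    have rev: "wp (While (EVar 10) reverse_step) ?s3 (\<lambda>t s'. t \<le> 10 * length (rev (map enc_bool ?w)) + 2 \<and>
      s' 7 = enc_list (rev (rev (map enc_bool ?w)) @ []) \<and> (\<forall>y. y \<notin> {7, 10} \<longrightarrow> s' y = ?s3 y))"
      by (rule wp_reverse) (use s2(2) in \<open>simp_all add: rev_map\<close>)
    have "val (EVar 9) s2 = Leaf" using True s2(1) by simp
    then show ?thesis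
      unfolding store_entry_def wp_Cond wp_Seq wp_Assign
      apply simp
      apply (rule wp_mono[OF rev])
      using t s2 assms True
      by (auto simp: Q_def extend_entry_def s1_def Let_def enc_entry_def enc_bool_def)
  qed
  note rest = this
  have "wp (Seq (While (EVar 8) scan_step) store_entry) s1 (\<lambda>u. Q (17 + u))"
    unfolding wp_Seq by (rule wp_mono[OF scan]) (use rest in auto)
  then have "wp entry_body s Q"
    using assms(1-3) by (simp add: entry_body_def s1_def enc_entry_def eval_nat_numeral)
  then show ?thesis unfolding Q_def .
qed

lemma wp_entries:
  fixes s :: state
  assumes "s 5 = enc_list (map enc_entry es)" "s 4 = enc_bools bs" "s 2 = enc_nat k"
    "s 3 = enc_list (map enc_entry fam)"
  shows "wp (While (EVar 5) entry_body) s (\<lambda>t s'. t \<le> length es * (40 * length bs + 62) + 2 \<and>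
    s' 3 = enc_list (map enc_entry (rev (concat (map (extend_entry k bs) es)) @ fam)) \<and>
    (if 0 \<in> fst ` set (concat (map (extend_entry k bs) es)) then s' 0 = enc_bool True \<and> s' 1 = Leaf
     else s' 0 = s 0 \<and> s' 1 = s 1) \<and> s' 2 = s 2)"
  using assms
proof (induction es arbitrary: s fam)
  case Nil
  then show ?case by (intro wp_WhileFalse) auto
next
  case (Cons e es)
  let ?e = "extend_entry k bs e" and ?es = "concat (map (extend_entry k bs) es)"
  have c: "concat (map (extend_entry k bs) (e # es)) = ?e @ ?es" by simp
  show ?case
    unfolding c
  proof (rule wp_WhileTrue)
    show "val (EVar 5) s \<noteq> Leaf" using Cons.prems by simp
    have s5: "s 5 = Node (enc_entry e) (enc_list (map enc_entry es))" using Cons.prems(1) by simp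
    show "wp entry_body s (\<lambda>t s'. wp (While (EVar 5) entry_body) s' (\<lambda>u s''.
      1 + cost (EVar 5) + t + u \<le> length (e # es) * (40 * length bs + 62) + 2 \<and>
      s'' 3 = enc_list (map enc_entry (rev (?e @ ?es) @ fam)) \<and>
      (if 0 \<in> fst ` set (?e @ ?es) then s'' 0 = enc_bool True \<and> s'' 1 = Leaf
       else s'' 0 = s 0 \<and> s'' 1 = s 1) \<and> s'' 2 = s 2))"
    proof (rule wp_mono[OF wp_entry_body[OF s5 Cons.prems(2-4)]], elim conjE)
      fix t :: nat and s' :: state
      assume t: "t \<le> 40 * length bs + 60" and s': "s' 5 = enc_list (map enc_entry es)"
        "s' 3 = enc_list (map enc_entry (rev ?e @ fam))" "s' 4 = s 4" "s' 2 = s 2"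
        and found: "if 0 \<in> fst ` set ?e then s' 0 = enc_bool True \<and> s' 1 = Leaf
          else s' 0 = s 0 \<and> s' 1 = s 1"
      have IH: "wp (While (EVar 5) entry_body) s' (\<lambda>t s''.
        t \<le> length es * (40 * length bs + 62) + 2 \<and>
        s'' 3 = enc_list (map enc_entry (rev ?es @ (rev ?e @ fam))) \<and>
        (if 0 \<in> fst ` set ?es then s'' 0 = enc_bool True \<and> s'' 1 = Leaf
         else s'' 0 = s' 0 \<and> s'' 1 = s' 1) \<and> s'' 2 = s' 2)"
        by (rule Cons.IH) (use s' Cons.prems in auto)
      show "wp (While (EVar 5) entry_body) s' (\<lambda>u s''.
        1 + cost (EVar 5) + t + u \<le> length (e # es) * (40 * length bs + 62) + 2 \<and>
        s'' 3 = enc_list (map enc_entry (rev (?e @ ?es) @ fam)) \<and>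
        (if 0 \<in> fst ` set (?e @ ?es) then s'' 0 = enc_bool True \<and> s'' 1 = Leaf
         else s'' 0 = s 0 \<and> s'' 1 = s 1) \<and> s'' 2 = s 2)"
      proof (rule wp_mono[OF IH], intro conjI)
        fix u :: nat and s'' :: state
        assume *: "u \<le> length es * (40 * length bs + 62) + 2 \<and>
          s'' 3 = enc_list (map enc_entry (rev ?es @ (rev ?e @ fam))) \<and>
          (if 0 \<in> fst ` set ?es then s'' 0 = enc_bool True \<and> s'' 1 = Leaf
           else s'' 0 = s' 0 \<and> s'' 1 = s' 1) \<and> s'' 2 = s' 2"
        show "1 + cost (EVar 5) + t + u \<le> length (e # es) * (40 * length bs + 62) + 2"
          using * t by simp
        show "s'' 3 = enc_list (map enc_entry (rev (?e @ ?es) @ fam))"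
          using * by (simp only: rev_append append_assoc)
        show "if 0 \<in> fst ` set (?e @ ?es) then s'' 0 = enc_bool True \<and> s'' 1 = Leaf
          else s'' 0 = s 0 \<and> s'' 1 = s 1"
          using * found by (simp only: set_append image_Un Un_iff split: if_splits) blast+
        show "s'' 2 = s 2" using * s'(4) by simp
      qed
    qed
  qed
qed

text \<open>The loop consumes a copy of the list in variable 5 while new entries go to variable 3,
  so a row is never added twice to the same entry.\<close>

definition row_body :: com where
  "row_body =
    Seq (Assign 4 (EHd (EVar 1)))
    (Seq (Assign 1 (ETl (EVar 1)))
    (Seq (Assign 5 (EVar 3)) (While (EVar 5) entry_body)))"

lemma wp_row_body:
  fixes s :: state
  assumes "s 1 = Node (enc_bools bs) rs" "s 2 = enc_nat k" "s 3 = enc_list (map enc_entry fam)"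
  shows "wp row_body s (\<lambda>t s'. t \<le> length fam * (40 * length bs + 62) + 10 \<and>
    s' 3 = enc_list (map enc_entry (rev (concat (map (extend_entry k bs) fam)) @ fam)) \<and>
    (if 0 \<in> fst ` set (concat (map (extend_entry k bs) fam)) then s' 0 = enc_bool True \<and> s' 1 = Leaf
     else s' 0 = s 0 \<and> s' 1 = rs) \<and> s' 2 = enc_nat k)"
proof -
  let ?s = "s(4 := enc_bools bs, 1 := rs, 5 := enc_list (map enc_entry fam))"
  have "wp (While (EVar 5) entry_body) ?s (\<lambda>t s'. t \<le> length fam * (40 * length bs + 62) + 2 \<and>
    s' 3 = enc_list (map enc_entry (rev (concat (map (extend_entry k bs) fam)) @ fam)) \<and>
    (if 0 \<in> fst ` set (concat (map (extend_entry k bs) fam)) then s' 0 = enc_bool True \<and> s' 1 = Leaf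
     else s' 0 = ?s 0 \<and> s' 1 = ?s 1) \<and> s' 2 = ?s 2)"
    by (rule wp_entries) (use assms in auto)
  then show ?thesis
    unfolding row_body_def wp_Seq wp_Assign using assms
    by (auto elim!: wp_mono split: if_splits)
qed

text \<open>A set \<open>S\<close> of rows is stored as the number of rows still missing and its bad columns.\<close>

definition bad :: "nat mat \<Rightarrow> nat set \<Rightarrow> bool list" where
  "bad M S = (if S = {} then [] else map (\<lambda>j. \<exists>i\<in>S. (i, j) \<notin> ones M) [0..<dim_col M])"

definition entry :: "nat mat \<Rightarrow> nat \<Rightarrow> nat set \<Rightarrow> nat \<times> bool list" where
  "entry M k S = (k - card S, bad M S)"

definition row_bits :: "nat mat \<Rightarrow> nat \<Rightarrow> bool list" where
  "row_bits M i = map (\<lambda>j. M $$ (i, j) = 1) [0..<dim_col M]"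

section \<open>Meaning of the stored entries\<close>

lemma merge_conv_nth:
  "vs = [] \<or> length vs = length bs \<Longrightarrow>
    merge vs bs = map (\<lambda>j. (vs \<noteq> [] \<and> vs ! j) \<or> \<not> bs ! j) [0..<length bs]"
proof (induction vs bs rule: merge.induct)
  case (2 vs b bs)
  have "tl vs = [] \<or> length (tl vs) = length bs" using 2(2) by auto
  note IH = 2(1)[OF this]
  have "map (\<lambda>j. (vs \<noteq> [] \<and> vs ! j) \<or> \<not> (b # bs) ! j) [0..<length (b # bs)] =
    ((vs \<noteq> [] \<and> hd vs) \<or> \<not> b) #
      map (\<lambda>j. (vs \<noteq> [] \<and> vs ! Suc j) \<or> \<not> bs ! j) [0..<length bs]"
    by (cases vs) (simp_all add: map_upt_Suc del: upt_Suc)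
  also have "map (\<lambda>j. (vs \<noteq> [] \<and> vs ! Suc j) \<or> \<not> bs ! j) [0..<length bs] =
    map (\<lambda>j. (tl vs \<noteq> [] \<and> tl vs ! j) \<or> \<not> bs ! j) [0..<length bs]"
    using 2(2) by (cases vs) auto
  finally show ?case using IH by simp
qed simp

text \<open>This covers \<open>S = {}\<close>, coded by the empty list: the program creates that
  entry before it knows the number of columns, and the first row supplies the length.\<close>

lemma merge_bad:
  assumes "i < dim_row M"
  shows "merge (bad M S) (row_bits M i) = bad M (insert i S)"
proof -
  have "merge (bad M S) (row_bits M i) = map (\<lambda>j. (bad M S \<noteq> [] \<and> bad M S ! j) \<or>
      \<not> row_bits M i ! j) [0..<length (row_bits M i)]"
    by (rule merge_conv_nth) (simp add: bad_def row_bits_def)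
  also have "\<dots> = bad M (insert i S)"
    using assms by (auto simp: bad_def ones_def row_bits_def)
  finally show ?thesis .
qed

lemma count_list_map_upt: "count_list (map P [0..<n]) False = card {j \<in> {..<n}. \<not> P j}"
proof (induction n)
  case (Suc n)
  have "{j \<in> {..<Suc n}. \<not> P j} = (if P n then {} else {n}) \<union> {j \<in> {..<n}. \<not> P j}"
    by (auto simp: less_Suc_eq)
  then show ?case using Suc by (auto simp: card_insert_if)
qed simp

text \<open>The code of \<open>{}\<close> is empty and shows no good column at all. Columns are
  counted only after a row has been inserted, so this case does not arise.\<close>

lemma count_bad:
  "S \<noteq> {} \<Longrightarrow> count_list (bad M S) False = card (common (ones M) {..<dim_col M} S)"
  by (simp add: bad_def count_list_map_upt common_def del: map_map)

lemma extend_entry_entry: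
  assumes "i < dim_row M" "finite S" "i \<notin> S"
  shows "extend_entry k (row_bits M i) (entry M k S) =
    (if k \<le> card (common (ones M) {..<dim_col M} (insert i S)) then [entry M k (insert i S)] else [])"
  using assms by (simp add: extend_entry_def entry_def merge_bad count_bad Let_def)

lemma concat_extend_entries:
  assumes "i < dim_row M" "\<And>S. S \<in> set Ss \<Longrightarrow> finite S \<and> i \<notin> S"
  shows "concat (map (extend_entry k (row_bits M i)) (map (entry M k) Ss)) =
    map (entry M k) (map (insert i)
      (filter (\<lambda>S. k \<le> card (common (ones M) {..<dim_col M} (insert i S))) Ss))"
  using assms(2)
proof (induction Ss)
  case (Cons S Ss)
  have "extend_entry k (row_bits M i) (entry M k S) =
    (if k \<le> card (common (ones M) {..<dim_col M} (insert i S)) then [entry M k (insert i S)] else [])"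
    using Cons.prems by (intro extend_entry_entry[OF assms(1)]) auto
  with Cons show ?case by simp
qed simp


lemma enc_mat_conv: "enc_mat M = enc_list (map (\<lambda>i. enc_bools (row_bits M i)) [0..<dim_row M])"
  by (simp add: enc_mat_def row_bits_def o_def)

section \<open>Prefixes of the matrix and the main loop\<close>

definition row_sets :: "nat mat \<Rightarrow> nat \<Rightarrow> nat \<Rightarrow> nat set set" where
  "row_sets M k i = {S. S \<subseteq> {..<i} \<and> S \<noteq> {} \<and> k \<le> card (common (ones M) {..<dim_col M} S)}"

definition prefix_free :: "nat mat \<Rightarrow> nat \<Rightarrow> nat \<Rightarrow> bool" where
  "prefix_free M k i \<longleftrightarrow> biclique_free k (ones M \<inter> {..<i} \<times> {..<dim_col M})"

lemma finite_common [simp]: "finite (common E {..<n::nat} S)"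
  by (simp add: common_def)

text \<open>Correctness of the stopping test: the row side of a biclique has at least
  \<open>k\<close> common columns and is therefore one of the stored sets, and a stored set with
  \<open>k\<close> or more elements contains the row side of a biclique.\<close>

lemma prefix_free_iff:
  assumes "0 < k"
  shows "prefix_free M k i \<longleftrightarrow> (\<forall>S\<in>row_sets M k i. card S < k)"
proof
  assume free: "prefix_free M k i"
  show "\<forall>S\<in>row_sets M k i. card S < k"
  proof
    fix S assume S: "S \<in> row_sets M k i"
    then have "finite S" by (auto simp: row_sets_def intro: finite_subset)
    show "card S < k"
    proof (rule biclique_freeD)
      show "biclique_free k ((ones M \<inter> {..<i} \<times> {..<dim_col M})\<inverse>)"
        using free unfolding prefix_free_def by (rule biclique_free_converse)
      show "common (ones M) {..<dim_col M} S \<times> S \<subseteq> (ones M \<inter> {..<i} \<times> {..<dim_col M})\<inverse>"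
        using S by (auto simp: row_sets_def common_def)
    qed (use S \<open>finite S\<close> in \<open>auto simp: row_sets_def\<close>)
  qed
next
  assume small: "\<forall>S\<in>row_sets M k i. card S < k"
  show "prefix_free M k i"
    unfolding prefix_free_def biclique_free_def
  proof (intro notI, elim exE conjE)
    fix A B assume AB: "card A = k" "card B = k" "A \<times> B \<subseteq> ones M \<inter> {..<i} \<times> {..<dim_col M}"
    have ne: "A \<noteq> {}" "B \<noteq> {}" using AB assms by auto
    have "B \<subseteq> common (ones M) {..<dim_col M} A" using AB(3) ne by (auto simp: common_def)
    then have "k \<le> card (common (ones M) {..<dim_col M} A)" using AB(2) card_mono[OF finite_common] by metis
    then have "A \<in> row_sets M k i" using AB(3) ne by (auto simp: row_sets_def)
    then show False using small AB(1) by auto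
  qed
qed

lemma has_biclique_iff_prefix: "has_biclique M k \<longleftrightarrow> \<not> prefix_free M k (dim_row M)"
proof (cases "k = 0")
  case True
  then have "has_biclique M k" unfolding has_biclique_iff by (intro exI[of _ "{}"]) simp
  moreover have "\<not> prefix_free M k (dim_row M)"
    using True biclique_free_pos unfolding prefix_free_def by blast
  ultimately show ?thesis by simp
next
  case False
  have "ones M \<inter> {..<dim_row M} \<times> {..<dim_col M} = ones M" by (auto simp: ones_def)
  moreover have "A \<subseteq> {..<dim_row M} \<and> B \<subseteq> {..<dim_col M}"
    if "card A = k" "card B = k" "A \<times> B \<subseteq> ones M" for A B
  proof -
    have "A \<noteq> {}" "B \<noteq> {}" using that False by auto
    then show ?thesis using that(3) by (auto simp: ones_def)
  qed
  ultimately show ?thesis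
    unfolding has_biclique_iff prefix_free_def biclique_free_def by blast
qed

lemma prefix_free_mono: "prefix_free M k j \<Longrightarrow> i \<le> j \<Longrightarrow> prefix_free M k i"
  unfolding prefix_free_def by (rule biclique_free_mono) auto

text \<open>Removing row \<open>i\<close> from a set can only enlarge its set of common columns, so
  every new set extends a stored one or \<open>{}\<close>. The empty set is kept apart because it
  stays in the list even if the matrix has fewer than \<open>k\<close> columns.\<close>

lemma row_sets_Suc:
  "row_sets M k (Suc i) = row_sets M k i \<union>
     insert i ` {S \<in> insert {} (row_sets M k i). k \<le> card (common (ones M) {..<dim_col M} (insert i S))}"
    (is "?L = ?R")
proof
  show "?R \<subseteq> ?L" by (auto simp: row_sets_def less_Suc_eq)
  show "?L \<subseteq> ?R"
  proof
    fix S assume S: "S \<in> ?L"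
    show "S \<in> ?R"
    proof (cases "i \<in> S")
      case False
      then have "S \<subseteq> {..<i}" using S by (auto simp: row_sets_def less_Suc_eq)
      then show ?thesis using S by (auto simp: row_sets_def)
    next
      case True
      let ?S = "S - {i}"
      have "?S \<subseteq> {..<i}" using S by (auto simp: row_sets_def less_Suc_eq)
      moreover have "card (common (ones M) {..<dim_col M} S) \<le> card (common (ones M) {..<dim_col M} ?S)"
        by (rule card_mono) (auto simp: common_def)
      ultimately have mem: "?S \<in> insert {} (row_sets M k i)" using S by (auto simp: row_sets_def)
      have eq: "insert i ?S = S" using True by auto
      have "k \<le> card (common (ones M) {..<dim_col M} (insert i ?S))"
        unfolding eq using S by (simp add: row_sets_def)
      with mem have "insert i ?S \<in> insert i ` {T \<in> insert {} (row_sets M k i).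
        k \<le> card (common (ones M) {..<dim_col M} (insert i T))}" by blast
      then show ?thesis unfolding eq by blast
    qed
  qed
qed

definition row_loop :: com where
  "row_loop = While (EVar 1) row_body"

text \<open>Invariant: the list enumerates \<open>{}\<close> and the row sets of a biclique-free
  prefix without repetition, hence its length is at most \<open>1 + B\<close>. A round is paid for
  by the list at its beginning, so the bound \<open>B\<close> is used for biclique-free prefixes
  only.\<close>

lemma wp_row_loop:
  fixes s :: state
  assumes k: "0 < k" and "i \<le> dim_row M" and "prefix_free M k i"
    and "distinct Ss" "set Ss = insert {} (row_sets M k i)"
    and "s 0 = Leaf" "s 2 = enc_nat k" "s 3 = enc_list (map enc_entry (map (entry M k) Ss))"
    and "s 1 = enc_list (map (\<lambda>i. enc_bools (row_bits M i)) [i..<dim_row M])"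
    and B: "\<And>i. i \<le> dim_row M \<Longrightarrow> prefix_free M k i \<Longrightarrow> card (row_sets M k i) \<le> B"
  shows "wp row_loop s (\<lambda>t s'. t \<le> (dim_row M - i) * ((1 + B) * (40 * dim_col M + 62) + 12) + 4 \<and>
    s' 0 = enc_bool (has_biclique M k))"
  using assms(2-9)
proof (induction "dim_row M - i" arbitrary: i Ss s)
  case 0
  then have i: "i = dim_row M" by simp
  then have "\<not> has_biclique M k" using 0(3) by (simp add: has_biclique_iff_prefix)
  then show ?case unfolding row_loop_def using 0 i by (intro wp_WhileFalse) (auto simp: enc_bool_def)
next
  case (Suc d)
  let ?bs = "row_bits M i" and ?C = "\<lambda>S. k \<le> card (common (ones M) {..<dim_col M} (insert i S))"
  let ?fam = "map (entry M k) Ss"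
  define new where "new = map (insert i) (filter ?C Ss)"
  have i: "i < dim_row M" using Suc(2) by simp
  have Ss: "finite S \<and> i \<notin> S" if "S \<in> set Ss" for S
    using that Suc.prems(4) by (auto simp: row_sets_def intro: finite_subset)
  have conc: "concat (map (extend_entry k ?bs) ?fam) = map (entry M k) new"
    unfolding new_def by (rule concat_extend_entries[OF i Ss])
  have set_new: "set new = insert i ` {S \<in> insert {} (row_sets M k i). ?C S}"
    using Suc.prems(4) by (auto simp: new_def)
  have set': "set (rev new @ Ss) = insert {} (row_sets M k (Suc i))"
    unfolding row_sets_Suc using set_new Suc.prems(4) by auto
  have dist': "distinct (rev new @ Ss)"
  proof -
    have "inj_on (insert i) (set Ss)" by (intro inj_onI) (metis Ss insert_ident)
    then have "inj_on (insert i) (set (filter ?C Ss))" by (rule inj_on_subset) auto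
    then have "distinct new" using Suc.prems(3) by (simp add: new_def distinct_map)
    moreover have "set new \<inter> set Ss = {}" using Ss by (auto simp: new_def)
    ultimately show ?thesis using Suc.prems(3) by auto
  qed
  \<comment> \<open>All sets stored before this row have fewer than \<open>k\<close> elements, so a
    set with \<open>k\<close> elements can only be a new one; testing the new entries
    suffices.\<close>
  have found: "0 \<in> fst ` set (map (entry M k) new) \<longleftrightarrow> \<not> prefix_free M k (Suc i)"
  proof -
    have "0 \<in> fst ` set (map (entry M k) new) \<longleftrightarrow> (\<exists>S\<in>set new. k \<le> card S)"
      by (force simp: entry_def)
    also have "\<dots> \<longleftrightarrow> (\<exists>S\<in>row_sets M k (Suc i). k \<le> card S)"
    proof
      assume "\<exists>S\<in>set new. k \<le> card S"
      then show "\<exists>S\<in>row_sets M k (Suc i). k \<le> card S" unfolding row_sets_Suc set_new by blast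
    next
      assume "\<exists>S\<in>row_sets M k (Suc i). k \<le> card S"
      then obtain S where S: "S \<in> row_sets M k (Suc i)" "k \<le> card S" by blast
      have "S \<notin> row_sets M k i"
        using S(2) Suc.prems(2) prefix_free_iff[OF k] by (auto simp: not_less)
      then show "\<exists>S\<in>set new. k \<le> card S" using S unfolding row_sets_Suc set_new by blast
    qed
    finally show ?thesis unfolding prefix_free_iff[OF k] by (simp add: not_less)
  qed
  have len: "length ?fam \<le> 1 + B"
  proof -
    have "length ?fam = card (insert {} (row_sets M k i))"
      using distinct_card[OF Suc.prems(3)] Suc.prems(4) by simp
    also have "\<dots> \<le> 1 + card (row_sets M k i)" by (simp add: card_insert_le_m1 card_insert_if)
    finally show ?thesis using B[OF Suc.prems(1,2)] by simp
  qed
  have lenbs: "length ?bs = dim_col M" by (simp add: row_bits_def)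
  have upt: "[i..<dim_row M] = i # [Suc i..<dim_row M]" using i by (rule upt_conv_Cons)
  have s1: "s 1 = Node (enc_bools ?bs) (enc_list (map (\<lambda>i. enc_bools (row_bits M i)) [Suc i..<dim_row M]))"
    using Suc.prems(8) unfolding upt by simp
  let ?R = "(1 + B) * (40 * dim_col M + 62) + 12"
  have d: "dim_row M - i = Suc (dim_row M - Suc i)" using i by simp
  show ?case
    unfolding row_loop_def
  proof (rule wp_WhileTrue)
    show "val (EVar 1) s \<noteq> Leaf" using s1 by simp
    show "wp row_body s (\<lambda>t s'. wp (While (EVar 1) row_body) s' (\<lambda>u s''.
      1 + cost (EVar 1) + t + u \<le> (dim_row M - i) * ?R + 4 \<and> s'' 0 = enc_bool (has_biclique M k)))"
    proof (rule wp_mono[OF wp_row_body[OF s1 Suc.prems(6,7)]], elim conjE)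
      fix t :: nat and s' :: state
      assume t0: "t \<le> length ?fam * (40 * length ?bs + 62) + 10"
        and s'3: "s' 3 = enc_list (map enc_entry (rev (concat (map (extend_entry k ?bs) ?fam)) @ ?fam))"
        and s'01: "if 0 \<in> fst ` set (concat (map (extend_entry k ?bs) ?fam))
          then s' 0 = enc_bool True \<and> s' 1 = Leaf
          else s' 0 = s 0 \<and> s' 1 = enc_list (map (\<lambda>i. enc_bools (row_bits M i)) [Suc i..<dim_row M])"
        and s'2: "s' 2 = enc_nat k"
      have t: "t + 2 \<le> ?R"
        using t0 mult_right_mono[OF len, of "40 * dim_col M + 62"] unfolding lenbs by simp
      show "wp (While (EVar 1) row_body) s' (\<lambda>u s''.
        1 + cost (EVar 1) + t + u \<le> (dim_row M - i) * ?R + 4 \<and> s'' 0 = enc_bool (has_biclique M k))"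
      proof (cases "prefix_free M k (Suc i)")
        case False
        then have "s' 0 = enc_bool True" "s' 1 = Leaf" using s'01 found unfolding conc by simp_all
        moreover have "has_biclique M k"
          using False prefix_free_mono[of M k "dim_row M" "Suc i"] i
          unfolding has_biclique_iff_prefix by auto
        ultimately show ?thesis
          using t by (intro wp_WhileFalse) (auto simp: d)
      next
        case True
        then have s'0: "s' 0 = Leaf"
          and s'1: "s' 1 = enc_list (map (\<lambda>i. enc_bools (row_bits M i)) [Suc i..<dim_row M])"
          using s'01 found Suc.prems(5) unfolding conc by simp_all
        have "s' 3 = enc_list (map enc_entry (map (entry M k) (rev new @ Ss)))"
          using s'3 unfolding conc by (simp add: rev_map)
        from Suc.hyps(1)[OF _ _ True dist' set' s'0 s'2 this s'1]
        have "wp row_loop s' (\<lambda>t s''. t \<le> (dim_row M - Suc i) * ?R + 4 \<and>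
          s'' 0 = enc_bool (has_biclique M k))"
          using Suc(2) i by simp
        then show ?thesis
          unfolding row_loop_def by (rule wp_mono) (use t in \<open>auto simp: d\<close>)
      qed
    qed
  qed
qed

text \<open>The list starts with the single entry for \<open>{}\<close>: \<open>k\<close> rows
  missing, no bad columns. The case \<open>k = 0\<close> is answered at once, because the loop tests
  only extended entries and would miss the empty biclique of a matrix without rows.\<close>

definition biclique_prog :: com where
  "biclique_prog =
    Seq (Assign 1 (EHd (EVar 0)))
    (Seq (Assign 2 (ETl (EVar 0)))
    (Seq (Assign 3 (ECons (ECons (EVar 2) ELeaf) ELeaf))
    (Seq (Cond (EVar 2) (Assign 0 ELeaf) (Seq (Assign 0 ETrue) (Assign 1 ELeaf)))
    row_loop)))"

lemma runs_biclique_prog: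
  assumes B: "\<And>i. i \<le> dim_row M \<Longrightarrow> prefix_free M k i \<Longrightarrow> card (row_sets M k i) \<le> B"
  shows "\<exists>t. runs biclique_prog (Node (enc_mat M) (enc_nat k)) t (enc_bool (has_biclique M k)) \<and>
    t \<le> dim_row M * ((1 + B) * (40 * dim_col M + 62) + 12) + 40"
proof -
  let ?s = "(\<lambda>_. Leaf)(0 := Node (enc_mat M) (enc_nat k))"
  have "wp biclique_prog ?s (\<lambda>t s'. s' 0 = enc_bool (has_biclique M k) \<and>
    t \<le> dim_row M * ((1 + B) * (40 * dim_col M + 62) + 12) + 40)"
  proof (cases "k = 0")
    case True
    then have "has_biclique M k"
      using biclique_free_pos unfolding has_biclique_iff_prefix prefix_free_def by blast
    then show ?thesis
      using True by (auto simp: biclique_prog_def row_loop_def enc_bool_def intro!: wp_WhileFalse)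
  next
    case False
    define s :: state where "s = ?s(1 := enc_mat M,
      2 := enc_nat k, 3 := Node (Node (enc_nat k) Leaf) Leaf, 0 := Leaf)"
    have "wp row_loop s (\<lambda>t s'. t \<le> (dim_row M - 0) * ((1 + B) * (40 * dim_col M + 62) + 12) + 4 \<and>
      s' 0 = enc_bool (has_biclique M k))"
    proof (rule wp_row_loop[where Ss = "[{}]"])
      have "row_sets M k 0 = {}" by (auto simp: row_sets_def)
      then show "set [{}] = insert {} (row_sets M k 0)" "prefix_free M k 0"
        using False by (auto simp: prefix_free_iff)
      show "s 1 = enc_list (map (\<lambda>i. enc_bools (row_bits M i)) [0..<dim_row M])"
        by (simp add: s_def enc_mat_conv)
    qed (use False B in \<open>auto simp: s_def entry_def bad_def enc_entry_def\<close>)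
    then show ?thesis
      using False by (auto simp: biclique_prog_def s_def elim!: wp_mono)
  qed
  then show ?thesis unfolding wp_def runs_def by blast
qed

section \<open>The polynomial running time\<close>

lemma leaves_pos: "1 \<le> leaves x"
  by (induction x) auto

lemma length_le_leaves: "length xs \<le> leaves (enc_list xs)"
  by (induction xs) (auto intro: order_trans[OF _ add_mono[OF leaves_pos]])

theorem theorem42:
  fixes \<M> :: "nat mat set"
  assumes "matrix_class \<M>"
    and "\<forall>M \<in> \<M>. zero_one_mat M"
    and "\<not> (\<forall>P. permutation_mat P \<longrightarrow> P \<in> \<M>)"
  shows "fpt_on \<M> enc_mat has_biclique"
proof -
  obtain P where P: "permutation_mat P" "P \<notin> \<M>" using assms(3) by blast
  define b where "b = sets_bound (dim_row P)"
  \<comment> \<open>Only a computable upper bound of \<open>400 * b k\<close> is taken. The number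
    400 covers the \<open>318 + 40\<close> that arises below.\<close>
  obtain h where h: "computable h" "\<And>k. 400 * b k \<le> h k"
    unfolding b_def using computably_bounded_sets_bound by (rule computably_boundedE) blast
  have "\<exists>t. runs biclique_prog (Node (enc_mat M) (enc_nat k)) t (enc_bool (has_biclique M k)) \<and>
      t \<le> h k * leaves (enc_mat M) ^ 3" if M: "M \<in> \<M>" for M k
  proof -
    define L where "L = leaves (enc_mat M)"
    let ?m = "dim_row M" and ?n = "dim_col M"
    have L: "1 \<le> L" unfolding L_def by (rule leaves_pos)
    have b: "1 \<le> b k" by (simp add: b_def sets_bound_def)
    have "card (row_sets M k i) \<le> (?m + ?n) * b k" if "i \<le> ?m" "prefix_free M k i" for i
    proof -
      have "card (row_sets M k i) \<le> (i + ?n) * b k"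
        unfolding row_sets_def b_def
        by (rule card_row_sets_class[OF assms(1,2) P M that(1) that(2)[unfolded prefix_free_def]])
      also have "\<dots> \<le> (?m + ?n) * b k" using that(1) by (intro mult_right_mono) auto
      finally show ?thesis .
    qed
    from runs_biclique_prog[OF this] obtain t
      where t: "runs biclique_prog (Node (enc_mat M) (enc_nat k)) t (enc_bool (has_biclique M k))"
        "t \<le> ?m * ((1 + (?m + ?n) * b k) * (40 * ?n + 62) + 12) + 40" by blast
    \<comment> \<open>The three factors \<open>L\<close> stand for the rows, the stored sets per row
      (at most linear for fixed \<open>k\<close>) and the columns scanned per set.\<close>
    have "t \<le> 400 * b k * L ^ 3"
    \<comment> \<open>A matrix without rows may have any number of columns although its code is a
      single leaf, so the columns are bounded by \<open>L\<close> only if there is a row.\<close>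
    proof (cases "?m = 0")
      case True
      then have "t \<le> 400 * 1" using t(2) by simp
      also have "\<dots> \<le> 400 * (b k * L ^ 3)" using b L by (intro mult_left_mono) auto
      finally show ?thesis by (simp add: mult.assoc)
    next
      case False
      have m: "?m \<le> L" using length_le_leaves[of "map (\<lambda>i. enc_bools (row_bits M i)) [0..<?m]"]
        by (simp add: L_def enc_mat_conv)
      have "?m * ?n \<le> L" unfolding L_def by (rule leaves_enc_mat_bounds)
      moreover have "?n \<le> ?m * ?n" using False by (cases ?m) auto
      ultimately have n: "?n \<le> L" by linarith
      define X where "X = b k * L"
      define Y where "Y = X * L"
      define W where "W = (1 + (?m + ?n) * b k) * (40 * ?n + 62)"
      have X: "1 \<le> X" unfolding X_def using b L by simp
      have Y: "1 \<le> Y" unfolding Y_def using X L by simp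
      have LY: "1 \<le> L * Y" using Y L by simp
      have "(?m + ?n) * b k \<le> (2 * L) * b k" using m n by (intro mult_right_mono) auto
      also have "\<dots> = 2 * X" by (simp add: X_def)
      finally have 1: "1 + (?m + ?n) * b k \<le> 3 * X" using X by linarith
      have 2: "40 * ?n + 62 \<le> 102 * L" using n L by simp
      have "W \<le> (3 * X) * (102 * L)" unfolding W_def using 1 2 by (rule mult_mono) auto
      also have "\<dots> = 306 * Y" by (simp add: Y_def)
      finally have "W + 12 \<le> 318 * Y" using Y by linarith
      then have "?m * (W + 12) \<le> L * (318 * Y)" using m by (intro mult_mono) auto
      also have "\<dots> = 318 * (L * Y)" by simp
      finally have "t \<le> 400 * (L * Y)" using t(2)[folded W_def] LY by linarith
      then show ?thesis by (simp add: X_def Y_def power3_eq_cube mult.assoc mult.left_commute)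
    qed
    also have "\<dots> \<le> h k * L ^ 3" using h(2) by (rule mult_right_mono) simp
    finally show ?thesis using t(1) unfolding L_def by blast
  qed
  then show ?thesis unfolding fpt_on_def using h(1) by blast
qed

end
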